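(* Let $\Omega\subset\mathbb{O}$ be a domain, let $f:\Omega\to\mathbb{O}$ be a slice Fueter-regular function, and let $\gamma_\Theta$ be a circular lifting (of a path $\gamma$ in $\mathbb{C}$ via a path $\Theta$ in $\mathbb{S}$) in $\Omega$, i.e. $\gamma_\Theta([0,1])\subset\Omega$. Then $$\phi_t:=\phi_f(\gamma(t),\Theta(t))\qquad(0\le t\le 1)$$ is a Bers-Vekua continuation along the path $\gamma$.
   Context: Octonions. $\mathbb{O}$ is the real (non-associative) division algebra with basis $e_0=1,e_1,\dots,e_7$, with $e_l e_l=-1$ for $l\ge 1$ and $e_le_m=\sum_n\epsilon_{lmn}e_n$ for $l\ne m$ in $\{1,\dots,7\}$, where $\epsilon_{lmn}$ is completely antisymmetric, equal to $1$ on $(1,2,3),(1,4,5),(1,7,6),(2,4,6),(2,5,7),(3,4,7),(3,6,5)$, and $0$ on triples that are not permutations of these. For $x=\sum_{l=0}^7x_le_l$: $\Re(x)=x_0$, $\Im(x)=\sum_{l=1}^7x_le_l$, $|x|=(\sum x_l^2)^{1/2}$. $\mathbb{O}=\mathbb{R}^8$ carries the Euclidean topology; a domain is a nonempty connected open set. $\mathbb{S}=\{I\in\mathbb{O}:\Re(I)=0,|I|=1\}$. For $z=\alpha+\beta i\in\mathbb{C}$ and $I\in\mathbb{S}$, $z_I=\tau_I(z)=\alpha+\beta I$. Slice functions and stem vectors. For $a\in\mathbb{R}$, $b>0$ let $\mathbb{S}(\Omega,a,b)=\{I\in\mathbb{S}: a+bI\in\Omega\}$. A function $f:\Omega\to\mathbb{O}$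 is a slice function if for every connected component $\Lambda$ of any nonempty $\mathbb{S}(\Omega,a,b)$ there is $(u,v)\in\mathbb{O}^2$ with $f(a+bI)=u+Iv$ for all $I\in\Lambda$; this pair is unique. For $x=a+bI\in\Omega\setminus\mathbb{R}$ with $b>0$, $I\in\mathbb{S}$, the stem vector $(u_x,v_x)$ of $f$ at $x$ is the pair $(u,v)$ for the component $\Lambda\ni I$; for $x\in\Omega\cap\mathbb{R}$ it is $(f(x),0)$. Local stem functions. For an open ball $B\subset\Omega$ put $B^I=\{z\in\mathbb{C}:z_I\in B\}$. The local stem function $(u_B,v_B):\bigcup_{I\in\mathbb{S}}B^I\to\mathbb{O}^2$ of $f$ on $B$ is defined, for $z=\alpha+\beta i\in B^I$, by $(u_B(z),v_B(z))=(u_{z_I},v_{z_I})$ if $\beta\ge0$ and $(u_{z_I},-v_{z_I})$ if $\beta<0$, where $(u_{z_I},v_{z_I})$ is the stem vector at $z_I$; it does not depend on the choice of $I$ with $z\in B^I$. Slice Fueter-regularity. Let $L_{mn}=x_m\frac{\partial}{\partial x_n}-x_n\frac{\partial}{\partial x_m}$ ($1\le m<n\le 7$), $\Gamma f=-\sum_{1\le m<n\le 7}e_m(e_n(L_{mn}f))$, $E=\sum_{l=1}^7x_l\frac{\partial}{\partial x_l}$, and $\overline{\partial}_Ff(x)=\frac{\partial f}{\partial x_0}(x)-\Im(x)^{-1}Ef(x)-\frac13\Im(x)^{-1}\Gamma f(x)$ for $x\in\Omega\setminus\mathbb{R}$. A slice function $f:\Omega\to\mathbb{O}$ of class $\mathcal{C}^1$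 is slice Fueter-regular if $\overline{\partial}_Ff\equiv0$ on $\Omega\setminus\mathbb{R}$. Bers-Vekua germs and continuation. For a nonempty open $O\subset\mathbb{C}$, $\mathcal{BV}(O)$ is the set of pairs $(u,v)$ of real analytic maps $O\to\mathbb{O}$ (in the real variables $\alpha,\beta$, $z=\alpha+\beta i$) satisfying the Bers-Vekua system: $\frac{\partial u}{\partial\alpha}(z)-\frac{\partial v}{\partial\beta}(z)=2\frac{v(z)}{\beta}$ for $z\in O\setminus\mathbb{R}$, and $\frac{\partial u}{\partial\beta}(z)+\frac{\partial v}{\partial\alpha}(z)=0$ for $z\in O$. For $z\in\mathbb{C}$, two elements of $\bigcup_{O\ni z}\mathcal{BV}(O)$ ($O$ over open neighborhoods of $z$) are identified if they coincide on some open neighborhood of $z$; the class $[(u,v)]_z$ is the Bers-Vekua germ of $(u,v)$ at $z$. A path in a space $X$ is a continuous map $[0,1]\to X$. A Bers-Vekua continuation along a path $\gamma$ in $\mathbb{C}$ is a family of Bers-Vekua germs $\phi_t$ ($0\le t\le1$) such that for any $t^*\in[0,1]$ there exist a neighborhood $T\subset[0,1]$ of $t^*$, an open set $O\subset\mathbb{C}$ with $\gamma(T)\subset O$ and a pair $(u,v)\in\mathcal{BV}(O)$ with $\phi_t=[(u,v)]_{\gamma(t)}$ for every $t\in T$. $I$-germs and circular liftings. For $f$ slice Fueter-regular on $\Omega$, $z\in\mathbb{C}$ and $I\in\mathbb{S}$ with $z_I\in\Omega$, the $I$-germ of $f$ at $z$ is $\phi_f(z,I)=[(u_B,v_B)]_z$,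 where $B$ is an arbitrary open ball in $\Omega$ containing $z_I$ (for such $f$ one has $(u_B,v_B)\in\mathcal{BV}(\bigcup_{I\in\mathbb{S}}B^I)$, and the germ does not depend on $B$). For paths $\gamma$ in $\mathbb{C}$ and $\Theta$ in $\mathbb{S}$, the circular lifting of $\gamma$ via $\Theta$ is the path $\gamma_\Theta(t)=\tau_{\Theta(t)}(\gamma(t))$ in $\mathbb{O}$. *)

theory Defs
  imports "HOL-Analysis.Analysis"
begin

section \<open>Octonions\<close>

text \<open>
  The octonions are the Euclidean space with coordinates indexed by the eight elements
  \<open>0, 1, \<dots>, 7\<close> of the numeral type \<open>8\<close> (ordered in this way).  Norm and topology are those of
  the library.  Pitfall: the library's \<open>1\<close> and \<open>*\<close> on this type are the all-ones vector and the
  componentwise product; the octonionic unit is \<open>\<e> 0\<close> and the octonionic product is \<open>\<odot>\<close>.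
\<close>

type_synonym octonion = "real ^ 8"

definition oct_basis :: "8 \<Rightarrow> octonion" (\<open>\<e>\<close>) where
  "\<e> l = axis l 1"

definition oct_triples :: "(8 \<times> 8 \<times> 8) set" where
  "oct_triples = {(1,2,3), (1,4,5), (1,7,6), (2,4,6), (2,5,7), (3,4,7), (3,6,5)}"

definition oct_eps :: "8 \<Rightarrow> 8 \<Rightarrow> 8 \<Rightarrow> real" where
  "oct_eps l m n =
     (if (l,m,n) \<in> oct_triples \<or> (m,n,l) \<in> oct_triples \<or> (n,l,m) \<in> oct_triples then 1
      else if (m,l,n) \<in> oct_triples \<or> (l,n,m) \<in> oct_triples \<or> (n,m,l) \<in> oct_triples then - 1
      else 0)"

definition oct_basis_mult :: "8 \<Rightarrow> 8 \<Rightarrow> octonion" where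
  "oct_basis_mult l m =
     (if l = 0 then \<e> m
      else if m = 0 then \<e> l
      else if l = m then - \<e> 0
      else (\<Sum>n\<in>UNIV. oct_eps l m n *\<^sub>R \<e> n))"

definition oct_mult :: "octonion \<Rightarrow> octonion \<Rightarrow> octonion" (infixl \<open>\<odot>\<close> 70) where
  "x \<odot> y = (\<Sum>l\<in>UNIV. \<Sum>m\<in>UNIV. (x $ l * y $ m) *\<^sub>R oct_basis_mult l m)"

definition oct_Re :: "octonion \<Rightarrow> real" where
  "oct_Re x = x $ 0"

definition oct_Im :: "octonion \<Rightarrow> octonion" where
  "oct_Im x = (\<Sum>l\<in>UNIV - {0}. x $ l *\<^sub>R \<e> l)"

text \<open>The two-sided inverse of a nonzero octonion: its conjugate divided by its squared norm.\<close>

definition oct_inverse :: "octonion \<Rightarrow> octonion" where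
  "oct_inverse x = (1 / (norm x)\<^sup>2) *\<^sub>R (oct_Re x *\<^sub>R \<e> 0 - oct_Im x)"

definition oct_reals :: "octonion set" where
  "oct_reals = {x. oct_Im x = 0}"

definition imag_units :: "octonion set" (\<open>\<SS>\<close>) where
  "\<SS> = {I. oct_Re I = 0 \<and> norm I = 1}"

definition slice_embed :: "octonion \<Rightarrow> complex \<Rightarrow> octonion" (\<open>\<tau>\<close>) where
  "\<tau> I z = Re z *\<^sub>R \<e> 0 + Im z *\<^sub>R I"


section \<open>Slice functions and stem vectors\<close>

text \<open>
  A function on \<open>\<Omega>\<close> is represented by a total function together with the set \<open>\<Omega>\<close>;
  all notions below depend only on its values in \<open>\<Omega>\<close> (with \<open>\<Omega>\<close> open).
\<close>

definition slice_sphere :: "octonion set \<Rightarrow> real \<Rightarrow> real \<Rightarrow> octonion set" where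
  "slice_sphere \<Omega> a b = {I \<in> \<SS>. a *\<^sub>R \<e> 0 + b *\<^sub>R I \<in> \<Omega>}"

text \<open>The library's \<^const>\<open>components\<close> of the empty set is empty, so nonemptiness need not be required.\<close>

definition slice_function :: "octonion set \<Rightarrow> (octonion \<Rightarrow> octonion) \<Rightarrow> bool" where
  "slice_function \<Omega> f \<longleftrightarrow>
     (\<forall>a b. b > 0 \<longrightarrow>
        (\<forall>\<Lambda> \<in> components (slice_sphere \<Omega> a b).
           \<exists>u v. \<forall>I\<in>\<Lambda>. f (a *\<^sub>R \<e> 0 + b *\<^sub>R I) = u + I \<odot> v))"

definition stem_vector ::
  "octonion set \<Rightarrow> (octonion \<Rightarrow> octonion) \<Rightarrow> octonion \<Rightarrow> octonion \<times> octonion" where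
  "stem_vector \<Omega> f x =
     (if x \<in> oct_reals then (f x, 0)
      else THE (u, v). \<exists>a b I \<Lambda>. b > 0 \<and> I \<in> \<SS> \<and> x = a *\<^sub>R \<e> 0 + b *\<^sub>R I \<and>
             \<Lambda> \<in> components (slice_sphere \<Omega> a b) \<and> I \<in> \<Lambda> \<and>
             (\<forall>J\<in>\<Lambda>. f (a *\<^sub>R \<e> 0 + b *\<^sub>R J) = u + J \<odot> v))"

definition open_ball_in :: "octonion set \<Rightarrow> octonion set \<Rightarrow> bool" where
  "open_ball_in \<Omega> B \<longleftrightarrow> (\<exists>c r. r > 0 \<and> B = ball c r) \<and> B \<subseteq> \<Omega>"

text \<open>
  The local stem function \<open>(u\<^sub>B, v\<^sub>B)\<close>, as a pair of functions.  The description operator in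
  the auxiliary definition expresses the independence of the choice of \<open>I\<close>; the values are
  meaningful at those \<open>z\<close> for which \<open>\<tau> I z \<in> B\<close> for some \<open>I \<in> \<SS>\<close>.
\<close>

definition local_stem_value ::
  "octonion set \<Rightarrow> (octonion \<Rightarrow> octonion) \<Rightarrow> octonion set \<Rightarrow> complex \<Rightarrow> octonion \<times> octonion" where
  "local_stem_value \<Omega> f B z =
     (THE p. \<exists>I\<in>\<SS>. \<tau> I z \<in> B \<and>
        p = (let (u, v) = stem_vector \<Omega> f (\<tau> I z) in if Im z \<ge> 0 then (u, v) else (u, - v)))"

definition local_stem ::
  "octonion set \<Rightarrow> (octonion \<Rightarrow> octonion) \<Rightarrow> octonion set \<Rightarrow>
     (complex \<Rightarrow> octonion) \<times> (complex \<Rightarrow> octonion)" where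
  "local_stem \<Omega> f B =
     (\<lambda>z. fst (local_stem_value \<Omega> f B z), \<lambda>z. snd (local_stem_value \<Omega> f B z))"

section \<open>Slice Fueter-regularity\<close>

definition oct_partial :: "8 \<Rightarrow> (octonion \<Rightarrow> octonion) \<Rightarrow> octonion \<Rightarrow> octonion" where
  "oct_partial l f x = vector_derivative (\<lambda>t. f (x + t *\<^sub>R \<e> l)) (at 0)"

definition oct_L :: "8 \<Rightarrow> 8 \<Rightarrow> (octonion \<Rightarrow> octonion) \<Rightarrow> octonion \<Rightarrow> octonion" where
  "oct_L m n f x = x $ m *\<^sub>R oct_partial n f x - x $ n *\<^sub>R oct_partial m f x"

definition oct_Gamma :: "(octonion \<Rightarrow> octonion) \<Rightarrow> octonion \<Rightarrow> octonion" where
  "oct_Gamma f x = - (\<Sum>(m, n) \<in> {(m, n). 1 \<le> m \<and> m < n \<and> n \<le> 7}. \<e> m \<odot> (\<e> n \<odot> oct_L m n f x))"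

definition oct_Euler :: "(octonion \<Rightarrow> octonion) \<Rightarrow> octonion \<Rightarrow> octonion" where
  "oct_Euler f x = (\<Sum>l\<in>{1..7}. x $ l *\<^sub>R oct_partial l f x)"

definition slice_fueter_op :: "(octonion \<Rightarrow> octonion) \<Rightarrow> octonion \<Rightarrow> octonion" where
  "slice_fueter_op f x =
     oct_partial 0 f x - oct_inverse (oct_Im x) \<odot> oct_Euler f x
       - (1 / 3) *\<^sub>R (oct_inverse (oct_Im x) \<odot> oct_Gamma f x)"

definition C1_on :: "octonion set \<Rightarrow> (octonion \<Rightarrow> octonion) \<Rightarrow> bool" where
  "C1_on \<Omega> f \<longleftrightarrow>
     (\<exists>f' :: octonion \<Rightarrow> octonion \<Rightarrow>\<^sub>L octonion.
        (\<forall>x\<in>\<Omega>. (f has_derivative blinfun_apply (f' x)) (at x)) \<and> continuous_on \<Omega> f')"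

definition slice_fueter_regular :: "octonion set \<Rightarrow> (octonion \<Rightarrow> octonion) \<Rightarrow> bool" where
  "slice_fueter_regular \<Omega> f \<longleftrightarrow>
     slice_function \<Omega> f \<and> C1_on \<Omega> f \<and> (\<forall>x \<in> \<Omega> - oct_reals. slice_fueter_op f x = 0)"

section \<open>Bers-Vekua germs and continuation\<close>

text \<open>
  Real analyticity in the real variables \<open>\<alpha> = Re z\<close>, \<open>\<beta> = Im z\<close>: local expansion into a
  convergent double power series with coefficients in the target space.
\<close>

definition real_analytic_on :: "(complex \<Rightarrow> octonion) \<Rightarrow> complex set \<Rightarrow> bool" where
  "real_analytic_on u U \<longleftrightarrow>
     (\<forall>w\<in>U. \<exists>r>0. \<exists>c :: nat \<Rightarrow> nat \<Rightarrow> octonion. \<forall>z\<in>ball w r.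
        ((\<lambda>(i, j). (Re (z - w) ^ i * Im (z - w) ^ j) *\<^sub>R c i j) has_sum u z) UNIV)"

definition partial_alpha :: "(complex \<Rightarrow> octonion) \<Rightarrow> complex \<Rightarrow> octonion" where
  "partial_alpha u z = vector_derivative (\<lambda>t. u (z + of_real t)) (at 0)"

definition partial_beta :: "(complex \<Rightarrow> octonion) \<Rightarrow> complex \<Rightarrow> octonion" where
  "partial_beta u z = vector_derivative (\<lambda>t. u (z + of_real t * \<i>)) (at 0)"

text \<open>
  Pairs of maps on \<open>U\<close> are represented by pairs of total functions, whose values outside \<open>U\<close>
  are irrelevant: only their germs at points of \<open>U\<close> are used.
\<close>

definition bers_vekua ::
  "complex set \<Rightarrow> ((complex \<Rightarrow> octonion) \<times> (complex \<Rightarrow> octonion)) set" where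
  "bers_vekua U =
     {(u, v). real_analytic_on u U \<and> real_analytic_on v U \<and>
        (\<forall>z \<in> U - \<real>. partial_alpha u z - partial_beta v z = (2 / Im z) *\<^sub>R v z) \<and>
        (\<forall>z \<in> U. partial_beta u z + partial_alpha v z = 0)}"

type_synonym bv_germ = "((complex \<Rightarrow> octonion) \<times> (complex \<Rightarrow> octonion)) set"

definition bers_vekua_at ::
  "complex \<Rightarrow> ((complex \<Rightarrow> octonion) \<times> (complex \<Rightarrow> octonion)) set" where
  "bers_vekua_at z = (\<Union>U\<in>{U. open U \<and> z \<in> U}. bers_vekua U)"

definition germ_rel ::
  "complex \<Rightarrow> (((complex \<Rightarrow> octonion) \<times> (complex \<Rightarrow> octonion)) \<times>
               ((complex \<Rightarrow> octonion) \<times> (complex \<Rightarrow> octonion))) set" where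
  "germ_rel z = {((u, v), (u', v')).
     (u, v) \<in> bers_vekua_at z \<and> (u', v') \<in> bers_vekua_at z \<and>
     (\<exists>N. open N \<and> z \<in> N \<and> (\<forall>w\<in>N. u w = u' w \<and> v w = v' w))}"

definition bv_germs :: "complex \<Rightarrow> bv_germ set" where
  "bv_germs z = bers_vekua_at z // germ_rel z"

definition germ_of :: "(complex \<Rightarrow> octonion) \<times> (complex \<Rightarrow> octonion) \<Rightarrow> complex \<Rightarrow> bv_germ" where
  "germ_of p z = germ_rel z `` {p}"

definition bv_continuation :: "(real \<Rightarrow> complex) \<Rightarrow> (real \<Rightarrow> bv_germ) \<Rightarrow> bool" where
  "bv_continuation \<gamma> \<phi> \<longleftrightarrow>
     (\<forall>t\<in>{0..1}. \<phi> t \<in> bv_germs (\<gamma> t)) \<and>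
     (\<forall>t0\<in>{0..1}. \<exists>T U p.
        T \<subseteq> {0..1} \<and> (\<exists>V. openin (top_of_set {0..1}) V \<and> t0 \<in> V \<and> V \<subseteq> T) \<and>
        open U \<and> \<gamma> ` T \<subseteq> U \<and> p \<in> bers_vekua U \<and>
        (\<forall>t\<in>T. \<phi> t = germ_of p (\<gamma> t)))"

section \<open>\<open>I\<close>-germs and circular liftings\<close>

text \<open>The description operator expresses the independence of the choice of the ball.\<close>

definition I_germ ::
  "octonion set \<Rightarrow> (octonion \<Rightarrow> octonion) \<Rightarrow> complex \<Rightarrow> octonion \<Rightarrow> bv_germ" where
  "I_germ \<Omega> f z I =
     (THE \<phi>. \<exists>B. open_ball_in \<Omega> B \<and> \<tau> I z \<in> B \<and> \<phi> = germ_of (local_stem \<Omega> f B) z)"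

definition circular_lifting ::
  "(real \<Rightarrow> complex) \<Rightarrow> (real \<Rightarrow> octonion) \<Rightarrow> real \<Rightarrow> octonion" where
  "circular_lifting \<gamma> \<Theta> t = \<tau> (\<Theta> t) (\<gamma> t)"

end

(*
  The local stem functions (u, v) of f on a ball are C^1: near z they are recovered from the values
  of f on two slices I and J by solving u + I v = f(z_I), u + J v = f(z_J). On such pairs the slice
  Fueter operator at z_K equals (u_a - v_b - 2v/b) + K (v_a + u_b), so its vanishing on both
  slices is the Bers-Vekua system.

  Analyticity, also at the real axis, comes from Fueter's construction read backwards, one real
  component at a time: by the second equation there is a potential s with s_a = -u and s_b = v, the
  first equation says that b s is harmonic, and so F' = (s + b v) - i b u is holomorphic with
  Im F = b s. Hence b s, b u and b v = Re F' - s are real analytic, and dividing by b preserves this.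

  Finally, spherical caps cut out by balls are connected, which makes the stem vector at z_I
  the same for all balls containing z_I and all units I in such a cap; along a circular lifting one
  ball serves for all nearby parameters.
*)
theory Submission
  imports Defs "HOL-Complex_Analysis.Cauchy_Integral_Formula"
begin

section \<open>Octonion algebra\<close>

text \<open>Besides bilinearity, one identity replaces associativity: left multiplication by an
  imaginary x squares to -|x|^2. Hence the left multiplications by e_1, ..., e_7 satisfy Clifford
  relations, which is all that the operator \<Gamma> requires.

  In directions tangential to the 6-dimensional spheres around the real axis the derivative of f is
  dictated by v, and \<Gamma> contributes the factor 6. The normalisation 1/3 turns it into the
  coefficient 2 of the term 2v/b. Exactly this coefficient makes b s harmonic in the plane: s_aa +
  s_bb + (2/b) s_b = 0 is the Laplace equation on R x R^3 for functions of a and the distance b from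
  the axis. So the quaternionic form of Fueter's construction applies, although the space has
  dimension 8.

  The real axis is the main obstacle: the operator is imposed only off it and 2v/b is singular on
  it. The first equation is therefore carried as b (u_a - v_b) = 2v, which at b = 0 says v = 0, and
  the second one reaches the axis by continuity of the derivatives.

  Stem vectors, local stems and germs are all given by description operators; each is evaluated by
  first proving that there is a single candidate.\<close>

lemma UNIV_8: "(UNIV :: 8 set) = {0, 1, 2, 3, 4, 5, 6, 7}"
  by (rule card_subset_eq[symmetric]) auto

lemma sum_UNIV_8:
  "sum g (UNIV :: 8 set) = g 0 + g 1 + g 2 + g 3 + g 4 + g 5 + g 6 + (g 7 :: 'a :: comm_monoid_add)"
proof -
  have "distinct [0, 1, 2, 3, 4, 5, 6, 7 :: 8]" by simp
  then have "sum g (set [0, 1, 2, 3, 4, 5, 6, 7]) = sum_list (map g [0, 1, 2, 3, 4, 5, 6, 7])"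
    by (rule sum.distinct_set_conv_list)
  moreover have "(UNIV :: 8 set) = set [0, 1, 2, 3, 4, 5, 6, 7]" by (simp only: UNIV_8 list.set)
  ultimately show ?thesis
    by (simp only: list.map sum_list.Cons sum_list.Nil add.assoc add_0_right)
qed

lemma bounded_bilinear_oct_mult: "bounded_bilinear oct_mult"
proof (rule bilinear_conv_bounded_bilinear[THEN iffD1])
  have "linear (oct_mult x)" for x
    by (rule linearI)
      (simp_all only: oct_mult_def vector_add_component vector_scaleR_component real_scaleR_def
        distrib_left scaleR_add_left sum.distrib scaleR_sum_right scaleR_scaleR mult.left_commute)
  moreover have "linear (\<lambda>x. oct_mult x y)" for y
    by (rule linearI)
      (simp_all only: oct_mult_def vector_add_component vector_scaleR_component real_scaleR_def
        distrib_right scaleR_add_left sum.distrib scaleR_sum_right scaleR_scaleR mult.assoc)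
  ultimately show "bilinear oct_mult"
    by (simp add: bilinear_def)
qed

interpretation oct: bounded_bilinear oct_mult
  by (rule bounded_bilinear_oct_mult)

lemma oct_mult_nth_raw: "(x \<odot> y) $ k = (\<Sum>l\<in>UNIV. \<Sum>m\<in>UNIV. x $ l * y $ m * oct_basis_mult l m $ k)"
  by (simp add: oct_mult_def)

lemma oct_basis_nth: "\<e> l $ k = (if k = l then 1 else 0)"
  by (simp add: oct_basis_def axis_def)

lemma oct_basis_mult_nth: "oct_basis_mult l m $ k = (if l = 0 then if k = m then 1 else 0
   else if m = 0 then if k = l then 1 else 0 else if l = m then if k = 0 then - 1 else 0
   else oct_eps l m k)"
proof -
  have "(\<Sum>n\<in>UNIV. oct_eps l m n *\<^sub>R \<e> n) $ k = (\<Sum>n\<in>UNIV. if n = k then oct_eps l m n else 0)"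
    unfolding sum_component by (intro sum.cong) (auto simp: oct_basis_nth)
  then show ?thesis by (simp add: oct_basis_mult_def oct_basis_nth)
qed

text \<open>Through each index pass three of the seven triples, up to cyclic rotation. Sorting by
  the output index leaves only numeral tests when the product is expanded in coordinates.\<close>

lemma oct_eps_table:
  "oct_eps l m 0 = 0"
  "oct_eps l m 1 = (if (l, m) \<in> {(2, 3), (4, 5), (7, 6)} then 1 else if (m, l) \<in> {(2, 3), (4, 5), (7, 6)} then - 1 else 0)"
  "oct_eps l m 2 = (if (l, m) \<in> {(3, 1), (4, 6), (5, 7)} then 1 else if (m, l) \<in> {(3, 1), (4, 6), (5, 7)} then - 1 else 0)"
  "oct_eps l m 3 = (if (l, m) \<in> {(1, 2), (4, 7), (6, 5)} then 1 else if (m, l) \<in> {(1, 2), (4, 7), (6, 5)} then - 1 else 0)"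
  "oct_eps l m 4 = (if (l, m) \<in> {(5, 1), (6, 2), (7, 3)} then 1 else if (m, l) \<in> {(5, 1), (6, 2), (7, 3)} then - 1 else 0)"
  "oct_eps l m 5 = (if (l, m) \<in> {(1, 4), (7, 2), (3, 6)} then 1 else if (m, l) \<in> {(1, 4), (7, 2), (3, 6)} then - 1 else 0)"
  "oct_eps l m 6 = (if (l, m) \<in> {(1, 7), (2, 4), (5, 3)} then 1 else if (m, l) \<in> {(1, 7), (2, 4), (5, 3)} then - 1 else 0)"
  "oct_eps l m 7 = (if (l, m) \<in> {(6, 1), (2, 5), (3, 4)} then 1 else if (m, l) \<in> {(6, 1), (2, 5), (3, 4)} then - 1 else 0)"
  by (simp_all add: oct_eps_def oct_triples_def)

lemma oct_mult_nth:
  "(x \<odot> y) $ 0 = x$0*y$0 - x$1*y$1 - x$2*y$2 - x$3*y$3 - x$4*y$4 - x$5*y$5 - x$6*y$6 - x$7*y$7"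
  "(x \<odot> y) $ 1 = x$0*y$1 + x$1*y$0 + x$2*y$3 - x$3*y$2 + x$4*y$5 - x$5*y$4 - x$6*y$7 + x$7*y$6"
  "(x \<odot> y) $ 2 = x$0*y$2 + x$2*y$0 - x$1*y$3 + x$3*y$1 + x$4*y$6 - x$6*y$4 + x$5*y$7 - x$7*y$5"
  "(x \<odot> y) $ 3 = x$0*y$3 + x$3*y$0 + x$1*y$2 - x$2*y$1 + x$4*y$7 - x$7*y$4 + x$6*y$5 - x$5*y$6"
  "(x \<odot> y) $ 4 = x$0*y$4 + x$4*y$0 - x$1*y$5 + x$5*y$1 - x$2*y$6 + x$6*y$2 - x$3*y$7 + x$7*y$3"
  "(x \<odot> y) $ 5 = x$0*y$5 + x$5*y$0 + x$1*y$4 - x$4*y$1 - x$2*y$7 + x$7*y$2 + x$3*y$6 - x$6*y$3"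
  "(x \<odot> y) $ 6 = x$0*y$6 + x$6*y$0 + x$1*y$7 - x$7*y$1 + x$2*y$4 - x$4*y$2 - x$3*y$5 + x$5*y$3"
  "(x \<odot> y) $ 7 = x$0*y$7 + x$7*y$0 - x$1*y$6 + x$6*y$1 + x$2*y$5 - x$5*y$2 + x$3*y$4 - x$4*y$3"
  unfolding oct_mult_nth_raw oct_basis_mult_nth oct_eps_table sum_UNIV_8 by simp_all

lemma inner_oct: "x \<bullet> y = x$0*y$0 + x$1*y$1 + x$2*y$2 + x$3*y$3 + x$4*y$4 + x$5*y$5 + x$6*y$6 + x$7*y$7"
  for x y :: octonion
  by (simp add: inner_vec_def sum_UNIV_8)

lemma oct_eq_iff: "x = y \<longleftrightarrow> x$0 = y$0 \<and> x$1 = y$1 \<and> x$2 = y$2 \<and> x$3 = y$3 \<and> x$4 = y$4 \<and> x$5 = y$5 \<and> x$6 = y$6 \<and> x$7 = y$7"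
  for x y :: octonion
proof -
  have "(\<forall>k. P k) \<longleftrightarrow> (\<forall>k\<in>{0, 1, 2, 3, 4, 5, 6, 7}. P k)" for P :: "8 \<Rightarrow> bool"
    unfolding UNIV_8[symmetric] by simp
  then show ?thesis by (simp add: vec_eq_iff)
qed

text \<open>The substitute for associativity (left alternativity for imaginary x). In coordinates it
  is a polynomial identity in each of the eight components.\<close>

lemma oct_imag_mult_mult:
  assumes "x $ 0 = 0"
  shows "x \<odot> (x \<odot> y) = - (x \<bullet> x) *\<^sub>R y"
  unfolding oct_eq_iff vector_scaleR_component real_scaleR_def oct_mult_nth inner_oct assms
  by (intro conjI; algebra)

text \<open>Polarisation of \<open>oct_imag_mult_mult\<close>: expand the square for
  \<open>x + y\<close>; orthogonality kills the mixed inner product.\<close>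

lemma oct_imag_anticommute:
  assumes "x $ 0 = 0" "y $ 0 = 0" "x \<bullet> y = 0"
  shows "x \<odot> (y \<odot> w) = - (y \<odot> (x \<odot> w))"
proof -
  have "(x + y) \<odot> ((x + y) \<odot> w) = - ((x + y) \<bullet> (x + y)) *\<^sub>R w"
    using assms by (intro oct_imag_mult_mult) simp
  moreover have "x \<odot> (x \<odot> w) = - (x \<bullet> x) *\<^sub>R w" "y \<odot> (y \<odot> w) = - (y \<bullet> y) *\<^sub>R w"
    using assms by (simp_all add: oct_imag_mult_mult)
  ultimately have "x \<odot> (y \<odot> w) + y \<odot> (x \<odot> w) = 0"
    using assms(3) by (simp add: oct.add_left oct.add_right inner_add_left inner_add_right inner_commute algebra_simps)
  then show ?thesis by (simp only: eq_neg_iff_add_eq_0)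
qed

text \<open>Multiplying by x once more turns the product into a real multiple of y. It is applied to
  differences of two imaginary units.\<close>

lemma oct_imag_mult_eq_0:
  assumes "x $ 0 = 0" "x \<odot> y = 0"
  shows "x = 0 \<or> y = 0"
proof -
  have "(x \<bullet> x) *\<^sub>R y = 0"
    using oct_imag_mult_mult[OF assms(1), of y] assms(2) by (simp add: oct.zero_right)
  then show ?thesis by simp
qed

lemma oct_basis_mult_twice:
  assumes "m \<noteq> 0"
  shows "\<e> m \<odot> (\<e> m \<odot> w) = - w"
proof -
  have "\<e> m \<bullet> \<e> m = 1" by (simp add: oct_basis_def inner_axis_axis)
  with assms oct_imag_mult_mult[of "\<e> m" w] show ?thesis
    by (simp add: oct_basis_nth)
qed

lemma oct_basis_mult_thrice:
  assumes "m \<noteq> 0" "n \<noteq> 0" "m \<noteq> n"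
  shows "\<e> m \<odot> (\<e> n \<odot> (\<e> m \<odot> w)) = \<e> n \<odot> w"
proof -
  have "\<e> m \<bullet> \<e> n = 0" using assms by (simp add: oct_basis_def inner_axis_axis)
  then have "\<e> m \<odot> (\<e> n \<odot> (\<e> m \<odot> w)) = - (\<e> n \<odot> (\<e> m \<odot> (\<e> m \<odot> w)))"
    using assms by (intro oct_imag_anticommute) (simp_all add: oct_basis_nth)
  then show ?thesis using assms by (simp add: oct_basis_mult_twice oct.minus_right)
qed

lemma oct_Im_nth: "oct_Im x $ k = (if k = 0 then 0 else x $ k)"
proof -
  have "oct_Im x $ k = (\<Sum>l\<in>UNIV - {0}. if l = k then x $ l else 0)"
    unfolding oct_Im_def sum_component by (intro sum.cong) (auto simp: oct_basis_nth)
  then show ?thesis by simp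
qed

lemma oct_Im_eq: "oct_Im x = x - x $ 0 *\<^sub>R \<e> 0"
  by (auto simp: vec_eq_iff oct_Im_nth oct_basis_nth)

lemma index_pairs_8:
  "{(m, n). (1::8) \<le> m \<and> m < n \<and> n \<le> 7} =
    {(1,2),(1,3),(1,4),(1,5),(1,6),(1,7),(2,3),(2,4),(2,5),(2,6),(2,7),(3,4),(3,5),(3,6),(3,7),
     (4,5),(4,6),(4,7),(5,6),(5,7),(6,7)}" (is "?A = ?B")
proof -
  have "(m, n) \<in> ?A \<longleftrightarrow> (m, n) \<in> ?B" for m n
  proof -
    have "m \<in> {0, 1, 2, 3, 4, 5, 6, 7}" "n \<in> {0, 1, 2, 3, 4, 5, 6, 7}"
      using UNIV_8 by blast+
    then show ?thesis
      \<comment> \<open>All 64 pairs are tried; the order on the numeral type is that of its integer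
        representatives.\<close>
      by (elim insertE emptyE)
        (simp_all add: less_bit0_def less_eq_bit0_def bit0.Rep_numeral bit0.Rep_1 bit0.Rep_0)
  qed
  then show ?thesis by auto
qed

lemma index_1_7: "{1..7::8} = UNIV - {0}"
proof -
  have *: "1 \<le> l \<and> l \<le> 7 \<longleftrightarrow> l \<noteq> 0" for l :: 8
  proof -
    have "l \<in> {0, 1, 2, 3, 4, 5, 6, 7}"
      using UNIV_8 by blast
    then show ?thesis
      by (elim insertE emptyE)
        (simp_all add: less_eq_bit0_def bit0.Rep_numeral bit0.Rep_1 bit0.Rep_0)
  qed
  show ?thesis by (simp only: set_eq_iff atLeastAtMost_iff * Diff_iff UNIV_I insert_iff empty_iff) simp
qed

text \<open>Each of the seven indices belongs to exactly six of the 21 pairs. This is the 6 that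
  becomes the coefficient 2 after division by 3.\<close>

lemma sum_index_pairs_8:
  fixes g :: "8 \<Rightarrow> 'a :: real_vector"
  shows "(\<Sum>(m, n) \<in> {(m, n). 1 \<le> m \<and> m < n \<and> n \<le> 7}. g m + g n) = 6 *\<^sub>R (\<Sum>l\<in>UNIV - {0}. g l)"
proof -
  have "(\<Sum>l\<in>UNIV - {0}. g l) = g 1 + g 2 + g 3 + g 4 + g 5 + g 6 + g 7"
    using sum_UNIV_8[of g] sum.remove[of UNIV "0::8" g] by (simp add: add.assoc)
  moreover have "6 *\<^sub>R w = w + w + w + w + w + w" for w :: 'a
    using scaleR_left_distrib[of 1 5 w] scaleR_left_distrib[of 1 4 w] scaleR_left_distrib[of 1 3 w]
      scaleR_left_distrib[of 1 2 w] scaleR_left_distrib[of 1 1 w] by (simp add: add.assoc)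
  ultimately show ?thesis
    unfolding index_pairs_8 by (simp add: add_ac)
qed

section \<open>Spherical caps and stem vectors\<close>

lemma imag_units_iff: "I \<in> \<SS> \<longleftrightarrow> I $ 0 = 0 \<and> norm I = 1"
  by (simp add: imag_units_def oct_Re_def)

lemma minus_in_imag_units_iff: "- I \<in> \<SS> \<longleftrightarrow> I \<in> \<SS>"
  by (simp add: imag_units_iff)

lemma imag_units_mult_mult: "I \<in> \<SS> \<Longrightarrow> I \<odot> (I \<odot> y) = - y"
  by (simp add: imag_units_iff oct_imag_mult_mult dot_square_norm)

lemma oct_basis_inner: "\<e> l \<bullet> x = x $ l" "x \<bullet> \<e> l = x $ l"
  by (simp_all add: oct_basis_def inner_axis inner_commute[of "axis l 1"])

lemma norm_oct_basis: "norm (\<e> l) = 1"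
  by (simp add: oct_basis_def norm_axis_1)

lemma oct_basis_in_imag_units: "l \<noteq> 0 \<Longrightarrow> \<e> l \<in> \<SS>"
  by (simp add: imag_units_iff norm_oct_basis oct_basis_nth)

lemma slice_embed_minus_cnj: "\<tau> (- I) (cnj z) = \<tau> I z"
  by (simp add: slice_embed_def)

lemma slice_embed_nth_0: "I \<in> \<SS> \<Longrightarrow> \<tau> I z $ 0 = Re z"
  by (simp add: slice_embed_def imag_units_iff oct_basis_nth)

lemma slice_embed_diff: "\<tau> I z - \<tau> I w = \<tau> I (z - w)"
  by (simp add: slice_embed_def algebra_simps)

lemma norm_slice_embed: "I \<in> \<SS> \<Longrightarrow> norm (\<tau> I z) = norm z"
proof -
  assume I: "I \<in> \<SS>"
  then have "I \<bullet> I = 1" by (simp add: imag_units_iff dot_square_norm)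
  with I have "\<tau> I z \<bullet> \<tau> I z = (Re z)\<^sup>2 + (Im z)\<^sup>2"
    by (simp add: slice_embed_def inner_add_left inner_add_right
        oct_basis_inner oct_basis_nth imag_units_iff power2_eq_square)
  then show ?thesis by (simp add: norm_eq_sqrt_inner[of "\<tau> I z"] cmod_def)
qed

lemma dist_slice_embed: "I \<in> \<SS> \<Longrightarrow> dist (\<tau> I z) (\<tau> I w) = dist z w"
  by (simp add: dist_norm slice_embed_diff norm_slice_embed)

lemma dist_slice_embed_units: "dist (\<tau> I z) (\<tau> J z) = \<bar>Im z\<bar> * dist I J"
proof -
  have "\<tau> I z - \<tau> J z = Im z *\<^sub>R (I - J)" by (simp add: slice_embed_def algebra_simps)
  then show ?thesis by (simp add: dist_norm)
qed

lemma slice_embed_real_iff: "I \<in> \<SS> \<Longrightarrow> \<tau> I z \<in> oct_reals \<longleftrightarrow> Im z = 0"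
proof -
  assume I: "I \<in> \<SS>"
  have "oct_Im (\<tau> I z) = Im z *\<^sub>R I"
    using I by (simp add: oct_Im_eq slice_embed_nth_0) (simp add: slice_embed_def)
  moreover have "I \<noteq> 0" using I by (auto simp: imag_units_iff)
  ultimately show ?thesis by (simp add: oct_reals_def)
qed

lemma slice_embed_inject:
  assumes "I \<in> \<SS>" "J \<in> \<SS>" "Im z > 0" "Im w > 0" "\<tau> I z = \<tau> J w"
  shows "z = w" "I = J"
proof -
  have Re: "Re z = Re w" using assms slice_embed_nth_0 by metis
  then have IJ: "Im z *\<^sub>R I = Im w *\<^sub>R J" using assms(5) by (simp add: slice_embed_def)
  then have "norm (Im z *\<^sub>R I) = norm (Im w *\<^sub>R J)" by simp
  then have "Im z = Im w" using assms by (simp add: imag_units_iff)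
  with Re IJ assms show "z = w" "I = J" by (auto simp: complex_eq_iff)
qed

lemma ex_orthogonal_imag_unit: "\<exists>T\<in>\<SS>. d \<bullet> T = 0"
proof (cases "d $ 1 = 0")
  case True
  then show ?thesis
    using oct_basis_in_imag_units[of 1] by (intro bexI[of _ "\<e> 1"]) (simp_all add: oct_basis_inner)
next
  case False
  \<comment> \<open>The projection of d to the plane of e_1 and e_2, turned by a right
    angle.\<close>
  define T where "T = d $ 1 *\<^sub>R \<e> 2 - d $ 2 *\<^sub>R \<e> 1"
  have "T $ 2 = d $ 1" by (simp add: T_def oct_basis_nth)
  then have "T \<noteq> 0" using False by auto
  moreover have "d \<bullet> T = 0" by (simp add: T_def inner_diff_right oct_basis_inner)
  moreover have "T $ 0 = 0" by (simp add: T_def oct_basis_nth)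
  ultimately show ?thesis
    by (intro bexI[of _ "T /\<^sub>R norm T"]) (simp_all add: imag_units_iff)
qed

lemma great_circle_in_imag_units:
  assumes "I \<in> \<SS>" "T \<in> \<SS>" "I \<bullet> T = 0" "a\<^sup>2 + b\<^sup>2 = 1"
  shows "a *\<^sub>R I + b *\<^sub>R T \<in> \<SS>"
proof -
  have "I \<bullet> I = 1" "T \<bullet> T = 1" using assms by (simp_all add: imag_units_iff dot_square_norm)
  then show ?thesis
    using assms by (simp add: imag_units_iff norm_eq_sqrt_inner[of "a *\<^sub>R I + b *\<^sub>R T"]
        inner_add_left inner_add_right inner_commute[of T I] power2_eq_square)
qed

text \<open>A single slice does not determine a pair (u, v), so a second unit is needed inside every
  open set. It is found by turning I slightly towards an orthogonal unit T; for angles in (0, pi)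
  the T-component is positive, so the result differs from I.\<close>

lemma ex_nearby_imag_unit:
  assumes I: "I \<in> \<SS>" and e: "e > 0"
  shows "\<exists>J\<in>\<SS>. J \<noteq> I \<and> dist I J < e"
proof -
  obtain T where T: "T \<in> \<SS>" "I \<bullet> T = 0" using ex_orthogonal_imag_unit by blast
  define p where "p t = cos t *\<^sub>R I + sin t *\<^sub>R T" for t :: real
  have "isCont p 0" unfolding p_def by (intro continuous_intros)
  then have "(p \<longlongrightarrow> I) (at_right 0)"
    by (simp add: isCont_def p_def filterlim_at_split)
  from tendstoD[OF this e] have "\<forall>\<^sub>F t in at_right 0. dist (p t) I < e" .
  moreover have "\<forall>\<^sub>F t in at_right 0. t < pi"
    using pi_gt_zero by (intro eventually_at_rightI[of 0 pi]) auto
  moreover have "\<forall>\<^sub>F t in at_right (0::real). t > 0" by (rule eventually_at_right_less)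
  ultimately have "\<forall>\<^sub>F t in at_right 0. dist (p t) I < e \<and> 0 < t \<and> t < pi"
    by eventually_elim simp
  then obtain t where t: "dist (p t) I < e" "0 < t" "t < pi"
    using eventually_happens[of _ "at_right (0::real)"] by auto
  have "T \<bullet> T = 1" using T by (simp add: imag_units_iff dot_square_norm)
  then have "p t \<bullet> T = sin t" using T by (simp add: p_def inner_add_left)
  moreover have "sin t > 0" using t by (simp add: sin_gt_zero)
  ultimately have "p t \<noteq> I" using T by auto
  moreover have "p t \<in> \<SS>"
    unfolding p_def by (rule great_circle_in_imag_units[OF I T]) simp
  ultimately show ?thesis using t by (auto simp: dist_commute)
qed

text \<open>Every point of the cap is joined to the pole \<open>D\<close> by an arc along which the height
  over the hyperplane orthogonal to \<open>d\<close> only grows; this also covers caps larger than a hemisphere.\<close>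

lemma connected_halfspace_cap:
  assumes d: "d $ 0 = 0"
  shows "connected {K \<in> \<SS>. \<kappa> < K \<bullet> d}" (is "connected ?C")
proof -
  obtain D where D: "D \<in> \<SS>" "d = norm d *\<^sub>R D"
  proof (cases "d = 0")
    case True
    then show ?thesis using that[of "\<e> 1"] oct_basis_in_imag_units[of 1] by simp
  next
    case False
    then show ?thesis using d that[of "d /\<^sub>R norm d"] by (simp add: imag_units_iff)
  qed
  have DD: "D \<bullet> D = 1" using D by (simp add: imag_units_iff dot_square_norm)
  have to_pole: "connected_component ?C K D" if K: "K \<in> ?C" for K
  proof -
    define k where "k = K \<bullet> D"
    have KK: "K \<bullet> K = 1" using K by (simp add: imag_units_iff dot_square_norm)
    \<comment> \<open>Gram-Schmidt: the length of the part of K orthogonal to D, used to write K as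
      a point of a great circle through D.\<close>
    have sq: "(K - k *\<^sub>R D) \<bullet> (K - k *\<^sub>R D) = 1 - k\<^sup>2"
      by (simp add: inner_diff_left inner_diff_right KK DD k_def inner_commute power2_eq_square)
    then have k2: "k\<^sup>2 \<le> 1" using inner_ge_zero[of "K - k *\<^sub>R D"] by simp
    then have "\<bar>k\<bar> \<le> 1" by (simp only: abs_square_le_1)
    then have k: "- 1 \<le> k" "k \<le> 1" by linarith+
    obtain T where T: "T \<in> \<SS>" "D \<bullet> T = 0" "K = k *\<^sub>R D + sqrt (1 - k\<^sup>2) *\<^sub>R T"
    proof (cases "k\<^sup>2 = 1")
      case True
      then have "K = k *\<^sub>R D" using sq by simp
      then show ?thesis using ex_orthogonal_imag_unit[of D] that True by auto
    next
      case False
      define h where "h = sqrt (1 - k\<^sup>2)"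
      have h: "h > 0" using False k2 by (simp add: h_def)
      have "norm (K - k *\<^sub>R D) = h" using sq by (simp add: norm_eq_sqrt_inner h_def)
      then have "(K - k *\<^sub>R D) /\<^sub>R h \<in> \<SS>"
        using h K D by (simp add: imag_units_iff)
      moreover have "D \<bullet> ((K - k *\<^sub>R D) /\<^sub>R h) = 0"
        by (simp add: inner_diff_right DD k_def inner_commute)
      moreover have "K = k *\<^sub>R D + h *\<^sub>R ((K - k *\<^sub>R D) /\<^sub>R h)" using h by simp
      ultimately show ?thesis using that unfolding h_def by blast
    qed
    \<comment> \<open>The arc is parametrised by its height s over the equator of D, from
      \<open>p k = K\<close> to \<open>p 1 = D\<close>; the inner product with d is then
      \<open>norm d * s\<close>, visibly nondecreasing.\<close>
    define p where "p s = s *\<^sub>R D + sqrt (1 - s\<^sup>2) *\<^sub>R T" for s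
    have "connected (p ` {k..1})"
      unfolding p_def by (intro connected_continuous_image continuous_intros) simp
    moreover have "p ` {k..1} \<subseteq> ?C"
    proof safe
      fix s assume s: "s \<in> {k..1}"
      then have "\<bar>s\<bar> \<le> 1" using k by auto
      then have "s\<^sup>2 \<le> 1" by (simp only: abs_square_le_1)
      then show "p s \<in> \<SS>"
        unfolding p_def by (intro great_circle_in_imag_units D T) simp
      have "p s \<bullet> D = s" using T by (simp add: p_def inner_add_left DD inner_commute[of T D])
      moreover have "norm d * k \<le> norm d * s" using s by (intro mult_left_mono) auto
      moreover have "x \<bullet> d = norm d * (x \<bullet> D)" for x using D(2) by (metis inner_scaleR_right)
      ultimately show "\<kappa> < p s \<bullet> d" using K by (auto simp: k_def)
    qed
    moreover have "K \<in> p ` {k..1}"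
      using k T by (intro image_eqI[of _ p k]) (simp_all add: p_def)
    moreover have "D \<in> p ` {k..1}"
      using k by (intro image_eqI[of _ p 1]) (simp_all add: p_def)
    ultimately show ?thesis
      unfolding connected_component_def by blast
  qed
  then show ?thesis
    unfolding connected_iff_connected_component
    using connected_component_trans[OF to_pole connected_component_sym[OF to_pole]] by simp
qed

text \<open>The points \<open>\<tau> K z\<close> all have norm |z|, so their squared distance to c
  is affine in K. Lying in the ball is thus a half-space condition on K, and \<open>\<kappa>\<close>
  is the threshold obtained by solving for the inner product.\<close>

lemma connected_ball_cap: "connected {K \<in> \<SS>. \<tau> K z \<in> ball c r}"
proof (cases "r > 0")
  case True
  define \<kappa> where "\<kappa> = ((norm z)\<^sup>2 - 2 * Re z * c $ 0 + (norm c)\<^sup>2 - r\<^sup>2) / 2"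
  have "\<tau> K z \<in> ball c r \<longleftrightarrow> \<kappa> < K \<bullet> (Im z *\<^sub>R oct_Im c)" if K: "K \<in> \<SS>" for K
  proof -
    have "\<bar>norm (\<tau> K z - c)\<bar> < \<bar>r\<bar> \<longleftrightarrow> (norm (\<tau> K z - c))\<^sup>2 < r\<^sup>2"
      using abs_le_square_iff[of r "norm (\<tau> K z - c)"] by linarith
    then have "\<tau> K z \<in> ball c r \<longleftrightarrow> (norm (\<tau> K z - c))\<^sup>2 < r\<^sup>2"
      using True by (simp add: dist_norm norm_minus_commute[of c])
    also have "(norm (\<tau> K z - c))\<^sup>2 = (norm (\<tau> K z))\<^sup>2 - 2 * (\<tau> K z \<bullet> c) + (norm c)\<^sup>2"
      by (simp add: power2_norm_eq_inner inner_diff_left inner_diff_right inner_commute)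
    also have "norm (\<tau> K z) = norm z" using K by (rule norm_slice_embed)
    also have "\<tau> K z \<bullet> c = Re z * c $ 0 + K \<bullet> (Im z *\<^sub>R oct_Im c)"
      using K by (simp add: slice_embed_def inner_add_left oct_basis_inner oct_Im_eq inner_diff_right imag_units_iff)
    finally show ?thesis by (auto simp: \<kappa>_def)
  qed
  then have "{K \<in> \<SS>. \<tau> K z \<in> ball c r} = {K \<in> \<SS>. \<kappa> < K \<bullet> (Im z *\<^sub>R oct_Im c)}"
    by blast
  moreover have "(Im z *\<^sub>R oct_Im c) $ 0 = 0" by (simp add: oct_Im_nth)
  ultimately show ?thesis by (simp only: connected_halfspace_cap)
next
  case False
  then have "ball c r = {}" by simp
  then have "{K \<in> \<SS>. \<tau> K z \<in> ball c r} = {}" by blast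
  then show ?thesis by (simp only: connected_empty)
qed

text \<open>Subtracting the two equations leaves (I - J) times v' - v, where I - J is a nonzero
  imaginary octonion. It serves twice: for uniqueness of stem vectors, and to split an octonionic
  equation valid on two slices into a system.\<close>

lemma imag_unit_pair_unique:
  assumes "I \<in> \<SS>" "J \<in> \<SS>" "I \<noteq> J" "u + I \<odot> v = u' + I \<odot> v'" "u + J \<odot> v = u' + J \<odot> v'"
  shows "u = u'" "v = v'"
proof -
  have "u - u' = I \<odot> (v' - v)" "u - u' = J \<odot> (v' - v)"
    using assms(4,5) by (simp_all add: oct.diff_right algebra_simps)
  then have "(I - J) \<odot> (v' - v) = 0" by (simp add: oct.diff_left)
  then have "I - J = 0 \<or> v' - v = 0"
    using assms by (intro oct_imag_mult_eq_0) (simp_all add: imag_units_iff)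
  then show "v = v'" using assms by simp
  then show "u = u'" using assms by simp
qed

lemma slice_sphere_eq: "slice_sphere \<Omega> (Re z) (Im z) = {I \<in> \<SS>. \<tau> I z \<in> \<Omega>}"
  by (simp add: slice_sphere_def slice_embed_def)

text \<open>The description has one candidate because the component contains a second unit: a ball
  around \<open>\<tau> I z\<close> inside \<Omega> cuts out a connected cap, which must lie in
  \<Lambda> and contains units J close to I.\<close>

lemma stem_vector_eq:
  assumes \<Omega>: "open \<Omega>" and z: "Im z > 0" and I: "I \<in> \<SS>" "\<tau> I z \<in> \<Omega>"
    and \<Lambda>: "\<Lambda> \<in> components (slice_sphere \<Omega> (Re z) (Im z))" "I \<in> \<Lambda>"
    and uv: "\<And>J. J \<in> \<Lambda> \<Longrightarrow> f (\<tau> J z) = u + J \<odot> v"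
  shows "stem_vector \<Omega> f (\<tau> I z) = (u, v)"
proof -
  obtain r where r: "r > 0" "ball (\<tau> I z) r \<subseteq> \<Omega>"
    using \<Omega> I openE by blast
  have "r / Im z > 0" using r z by simp
  then obtain J where J: "J \<in> \<SS>" "J \<noteq> I" "dist I J < r / Im z"
    using ex_nearby_imag_unit[OF I(1)] by blast
  have "J \<in> \<Lambda>"
  proof -
    define C where "C = {K \<in> \<SS>. \<tau> K z \<in> ball (\<tau> I z) r}"
    have "connected C" unfolding C_def by (rule connected_ball_cap)
    moreover have "C \<subseteq> slice_sphere \<Omega> (Re z) (Im z)" using r by (auto simp: C_def slice_sphere_eq)
    moreover have "I \<in> C" using I r by (simp add: C_def)
    ultimately have "C \<subseteq> \<Lambda>" using \<Lambda> components_maximal by blast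
    moreover have "J \<in> C"
      using J z by (simp add: C_def dist_slice_embed_units field_simps)
    ultimately show ?thesis by blast
  qed
  have "(THE (u, v). \<exists>a b I' \<Lambda>. b > 0 \<and> I' \<in> \<SS> \<and> \<tau> I z = a *\<^sub>R \<e> 0 + b *\<^sub>R I' \<and>
             \<Lambda> \<in> components (slice_sphere \<Omega> a b) \<and> I' \<in> \<Lambda> \<and>
             (\<forall>J\<in>\<Lambda>. f (a *\<^sub>R \<e> 0 + b *\<^sub>R J) = u + J \<odot> v)) = (u, v)" (is "(THE (u, v). ?P u v) = _")
  proof (rule the_equality)
    show "case (u, v) of (u, v) \<Rightarrow> ?P u v"
      unfolding prod.case
      by (rule exI[of _ "Re z"], rule exI[of _ "Im z"], rule exI[of _ I], rule exI[of _ \<Lambda>])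
        (use z I \<Lambda> uv in \<open>simp add: slice_embed_def\<close>)
  next
    fix p assume p: "case p of (u, v) \<Rightarrow> ?P u v"
    obtain u' v' where p': "p = (u', v')" by force
    with p obtain a b I' \<Lambda>' where *: "b > 0" "I' \<in> \<SS>" "\<tau> I z = a *\<^sub>R \<e> 0 + b *\<^sub>R I'"
      "\<Lambda>' \<in> components (slice_sphere \<Omega> a b)" "I' \<in> \<Lambda>'"
      and uv': "\<forall>J\<in>\<Lambda>'. f (a *\<^sub>R \<e> 0 + b *\<^sub>R J) = u' + J \<odot> v'"
      unfolding p' prod.case by blast
    \<comment> \<open>Positive imaginary parts make the representation of the point unique, so a
      competing pair refers to the same z, I and component.\<close>
    have "\<tau> I z = \<tau> I' (Complex a b)" using * by (simp add: slice_embed_def)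
    then have "z = Complex a b" "I = I'"
      using slice_embed_inject[OF I(1) *(2) z, of "Complex a b"] * by auto
    moreover from this have "\<Lambda>' = \<Lambda>"
      using * \<Lambda> components_eq[of \<Lambda>' _ \<Lambda>] by auto
    ultimately have "f (\<tau> K z) = u' + K \<odot> v'" if "K \<in> \<Lambda>" for K
      using uv' that by (simp add: slice_embed_def)
    then have "u' = u" "v' = v"
      using uv \<Lambda>(2) \<open>J \<in> \<Lambda>\<close> imag_unit_pair_unique[OF I(1) J(1) J(2)[symmetric], of u' v' u v] by simp_all
    then show "p = (u, v)" by (simp add: p')
  qed
  moreover have "\<tau> I z \<notin> oct_reals" using I z by (simp add: slice_embed_real_iff)
  ultimately show ?thesis by (simp add: stem_vector_def)
qed

text \<open>With this sign, \<open>f (\<tau> I z) = u + I \<odot> v\<close> also holds for \<open>Im z < 0\<close>.\<close>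

definition signed_stem_vector ::
  "octonion set \<Rightarrow> (octonion \<Rightarrow> octonion) \<Rightarrow> octonion \<Rightarrow> complex \<Rightarrow> octonion \<times> octonion" where
  "signed_stem_vector \<Omega> f I z =
     (let (u, v) = stem_vector \<Omega> f (\<tau> I z) in if Im z \<ge> 0 then (u, v) else (u, - v))"

text \<open>A connected set of units lies in one component of the slice sphere, and the pair of that
  component serves the whole set.\<close>

lemma stem_vector_connected:
  assumes \<Omega>: "open \<Omega>" and f: "slice_function \<Omega> f" and z: "Im z > 0"
    and C: "connected C" "C \<subseteq> \<SS>" "\<And>K. K \<in> C \<Longrightarrow> \<tau> K z \<in> \<Omega>"
  shows "\<exists>u v. \<forall>K\<in>C. stem_vector \<Omega> f (\<tau> K z) = (u, v) \<and> f (\<tau> K z) = u + K \<odot> v"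
proof (cases "C = {}")
  case False
  have "C \<subseteq> slice_sphere \<Omega> (Re z) (Im z)" using C by (auto simp: slice_sphere_eq)
  then obtain \<Lambda> where \<Lambda>: "\<Lambda> \<in> components (slice_sphere \<Omega> (Re z) (Im z))" "C \<subseteq> \<Lambda>"
    using exists_component_superset[of C "slice_sphere \<Omega> (Re z) (Im z)"] C False by blast
  then obtain u v where "\<And>J. J \<in> \<Lambda> \<Longrightarrow> f (\<tau> J z) = u + J \<odot> v"
    using f[unfolded slice_function_def, rule_format, OF z \<Lambda>(1)] by (auto simp: slice_embed_def)
  moreover from this have "stem_vector \<Omega> f (\<tau> K z) = (u, v)" if "K \<in> C" for K
    using that \<Lambda> C by (intro stem_vector_eq[OF \<Omega> z _ _ \<Lambda>(1)]) auto
  ultimately show ?thesis using \<Lambda>(2) by blast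
qed auto

lemma signed_stem_vector_connected:
  assumes \<Omega>: "open \<Omega>" and f: "slice_function \<Omega> f"
    and C: "connected C" "C \<subseteq> \<SS>" "\<And>K. K \<in> C \<Longrightarrow> \<tau> K z \<in> \<Omega>"
  shows "\<exists>u v. \<forall>K\<in>C. signed_stem_vector \<Omega> f K z = (u, v) \<and> f (\<tau> K z) = u + K \<odot> v"
proof -
  consider "Im z > 0" | "Im z = 0" | "Im z < 0" by linarith
  then show ?thesis
  proof cases
    case 1
    then show ?thesis
      using stem_vector_connected[OF \<Omega> f 1 C] by (simp add: signed_stem_vector_def)
  next
    case 2
    then have "\<tau> K z = Re z *\<^sub>R \<e> 0" for K by (simp add: slice_embed_def)
    moreover from this have "Re z *\<^sub>R \<e> 0 \<in> oct_reals"
      using slice_embed_real_iff[of "\<e> 1" z] oct_basis_in_imag_units[of 1] 2 by simp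
    ultimately show ?thesis
      using 2 by (intro exI[of _ "f (Re z *\<^sub>R \<e> 0)"] exI[of _ 0])
        (simp add: signed_stem_vector_def stem_vector_def oct.zero_right)
  next
    case 3
    \<comment> \<open>The lower half-plane is reduced to the upper one: \<open>\<tau> K z\<close> is
      also the point of \<open>cnj z\<close> in the slice of -K, and (-K) v = K (-v) accounts for
      the sign.\<close>
    have "connected (uminus ` C)" using C by (intro connected_continuous_image continuous_intros)
    moreover have "uminus ` C \<subseteq> \<SS>" using C by (auto simp: minus_in_imag_units_iff)
    moreover have "\<tau> K (cnj z) \<in> \<Omega>" if "K \<in> uminus ` C" for K
      using that C slice_embed_minus_cnj by auto
    ultimately have "\<exists>u v. \<forall>K\<in>uminus ` C.
        stem_vector \<Omega> f (\<tau> K (cnj z)) = (u, v) \<and> f (\<tau> K (cnj z)) = u + K \<odot> v"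
      using 3 by (intro stem_vector_connected[OF \<Omega> f]) simp_all
    then obtain u v where uv: "\<forall>K\<in>C. stem_vector \<Omega> f (\<tau> K z) = (u, v) \<and> f (\<tau> K z) = u + (- K) \<odot> v"
      by (auto simp: slice_embed_minus_cnj)
    have "signed_stem_vector \<Omega> f K z = (u, - v) \<and> f (\<tau> K z) = u + K \<odot> (- v)" if "K \<in> C" for K
      using that 3 uv by (simp add: signed_stem_vector_def oct.minus_left oct.minus_right)
    then show ?thesis by blast
  qed
qed

text \<open>The units that put z into B form one connected cap, so all of them give the same signed
  pair. The first conclusion compares different balls, the second one is the representation of f on
  every slice through B.\<close>

lemma local_stem_value_eq:
  assumes \<Omega>: "open \<Omega>" and f: "slice_function \<Omega> f" and B: "open_ball_in \<Omega> B"
    and I: "I \<in> \<SS>" "\<tau> I z \<in> B"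
  shows "local_stem_value \<Omega> f B z = signed_stem_vector \<Omega> f I z"
    and "f (\<tau> I z) = fst (local_stem_value \<Omega> f B z) + I \<odot> snd (local_stem_value \<Omega> f B z)"
proof -
  obtain c r where cr: "B = ball c r" "B \<subseteq> \<Omega>" using B by (auto simp: open_ball_in_def)
  have "connected {K \<in> \<SS>. \<tau> K z \<in> B}" unfolding cr by (rule connected_ball_cap)
  then have "\<exists>u v. \<forall>K\<in>{K \<in> \<SS>. \<tau> K z \<in> B}.
      signed_stem_vector \<Omega> f K z = (u, v) \<and> f (\<tau> K z) = u + K \<odot> v"
    by (rule signed_stem_vector_connected[OF \<Omega> f]) (use cr(2) in auto)
  then obtain u v where uv: "\<And>K. K \<in> \<SS> \<Longrightarrow> \<tau> K z \<in> B \<Longrightarrow>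
      signed_stem_vector \<Omega> f K z = (u, v) \<and> f (\<tau> K z) = u + K \<odot> v"
    by auto
  have "local_stem_value \<Omega> f B z = (u, v)"
    unfolding local_stem_value_def signed_stem_vector_def[symmetric]
    by (rule the_equality) (use uv I in force)+
  with uv I show "local_stem_value \<Omega> f B z = signed_stem_vector \<Omega> f I z"
    "f (\<tau> I z) = fst (local_stem_value \<Omega> f B z) + I \<odot> snd (local_stem_value \<Omega> f B z)"
    by auto
qed

section \<open>Double power series\<close>

text \<open>Scalar version of \<open>real_analytic_on\<close> at one point, since the argument
  treats one real component at a time; \<open>real_analytic_on_componentwise\<close> reassembles the
  components.\<close>

definition real_analytic_at :: "(complex \<Rightarrow> real) \<Rightarrow> complex \<Rightarrow> bool" where
  "real_analytic_at h w \<longleftrightarrow>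
     (\<exists>r>0. \<exists>c :: nat \<Rightarrow> nat \<Rightarrow> real. \<forall>z\<in>ball w r.
        ((\<lambda>(i, j). (Re (z - w) ^ i * Im (z - w) ^ j) * c i j) has_sum h z) UNIV)"

lemma real_analytic_atI:
  assumes "r > 0" and "\<And>z. z \<in> ball w r \<Longrightarrow>
    ((\<lambda>(i, j). (Re (z - w) ^ i * Im (z - w) ^ j) * c i j) has_sum h z) UNIV"
  shows "real_analytic_at h w"
  unfolding real_analytic_at_def using assms by (intro exI[of _ r] conjI exI[of _ c] ballI)

lemma real_analytic_at_diff:
  assumes "real_analytic_at h w" "real_analytic_at k w"
  shows "real_analytic_at (\<lambda>z. h z - k z) w"
proof -
  obtain r c where r: "r > 0" and c: "\<And>z. z \<in> ball w r \<Longrightarrow>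
      ((\<lambda>(i, j). (Re (z - w) ^ i * Im (z - w) ^ j) * c i j) has_sum h z) UNIV"
    using assms(1) unfolding real_analytic_at_def by blast
  obtain r' c' where r': "r' > 0" and c': "\<And>z. z \<in> ball w r' \<Longrightarrow>
      ((\<lambda>(i, j). (Re (z - w) ^ i * Im (z - w) ^ j) * c' i j) has_sum k z) UNIV"
    using assms(2) unfolding real_analytic_at_def by blast
  have "((\<lambda>(i, j). (Re (z - w) ^ i * Im (z - w) ^ j) * (c i j - c' i j)) has_sum h z - k z) UNIV"
    if "z \<in> ball w (min r r')" for z
  proof -
    have "z \<in> ball w r" "z \<in> ball w r'" using that by auto
    from has_sum_add[OF c[OF this(1)] has_sum_cmult_right[OF c'[OF this(2)], of "- 1"]] show ?thesis
      by (simp add: case_prod_unfold algebra_simps)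
  qed
  moreover have "min r r' > 0" using r r' by simp
  ultimately show ?thesis by (intro real_analytic_atI)
qed

lemma real_analytic_at_minus:
  assumes "real_analytic_at h w"
  shows "real_analytic_at (\<lambda>z. - h z) w"
proof -
  have "real_analytic_at (\<lambda>z. 0) w"
    unfolding real_analytic_at_def by (intro exI[of _ 1] exI[of _ "\<lambda>i j. 0"]) (auto intro!: has_sum_0)
  from real_analytic_at_diff[OF this assms] show ?thesis by simp
qed

text \<open>Binomial expansion of the powers of x + iy. The absolute values of the terms of degree n
  add up to |a n| (|x| + |y|)^n, so the first hypothesis is precisely what allows the regrouping by
  exponents.\<close>

lemma power_series_double_has_sum:
  fixes a :: "nat \<Rightarrow> complex" and x y :: real
  assumes summ: "summable (\<lambda>n. norm (a n) * (\<bar>x\<bar> + \<bar>y\<bar>) ^ n)"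
    and sums: "(\<lambda>n. a n * Complex x y ^ n) sums S"
  shows "((\<lambda>(i, j). (x ^ i * y ^ j) *\<^sub>R (of_nat ((i + j) choose i) * a (i + j) * \<i> ^ j)) has_sum S) UNIV"
proof -
  define T where "T = (\<lambda>(n, k). a n * (of_nat (n choose k) * of_real x ^ k * (\<i> * of_real y) ^ (n - k)))"
  have inner: "((\<lambda>k. T (n, k)) has_sum (a n * Complex x y ^ n)) {..n}" for n
  proof -
    have "a n * Complex x y ^ n = (\<Sum>k\<le>n. T (n, k))"
      unfolding Complex_eq binomial_ring T_def by (simp add: sum_distrib_left)
    then show ?thesis by simp
  qed
  have inner_norm: "((\<lambda>k. norm (T (n, k))) has_sum (norm (a n) * (\<bar>x\<bar> + \<bar>y\<bar>) ^ n)) {..n}" for n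
  proof -
    have "norm (a n) * (\<bar>x\<bar> + \<bar>y\<bar>) ^ n = (\<Sum>k\<le>n. norm (T (n, k)))"
      unfolding binomial_ring T_def
      by (simp add: sum_distrib_left norm_mult norm_power)
    then show ?thesis by simp
  qed
  have "(\<lambda>n. norm (a n) * (\<bar>x\<bar> + \<bar>y\<bar>) ^ n) summable_on UNIV"
    using summ by (intro summable_nonneg_imp_summable_on) auto
  then have "(\<lambda>p. norm (T p)) summable_on Sigma UNIV (\<lambda>n. {..n})"
    by (intro summable_on_SigmaI[OF inner_norm]) auto
  then have T_summ: "T summable_on Sigma UNIV (\<lambda>n. {..n})"
    by (rule abs_summable_summable)
  have "summable (\<lambda>n. norm (a n * Complex x y ^ n))"
  proof (rule summable_comparison_test'[OF summ, of 0])
    fix n :: nat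
    have "norm (Complex x y) \<le> \<bar>x\<bar> + \<bar>y\<bar>"
      using cmod_le[of "Complex x y"] by simp
    then show "norm (norm (a n * Complex x y ^ n)) \<le> norm (a n) * (\<bar>x\<bar> + \<bar>y\<bar>) ^ n"
      by (simp add: norm_mult norm_power power_mono mult_left_mono)
  qed
  then have "((\<lambda>n. a n * Complex x y ^ n) has_sum S) UNIV"
    using sums by (rule norm_summable_imp_has_sum)
  then have "(T has_sum S) (Sigma UNIV (\<lambda>n. {..n}))"
    by (intro has_sum_SigmaI[OF inner _ T_summ]) auto
  \<comment> \<open>From the triangle of pairs (n, k) with k at most n to all exponents (i, j) = (k,
    n - k).\<close>
  also have "?this \<longleftrightarrow> ?thesis"
    by (rule has_sum_reindex_bij_witness[of _ "\<lambda>(i, j). (i + j, i)" "\<lambda>(n, k). (k, n - k)"])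
      (auto simp: T_def power_mult_distrib scaleR_conv_of_real algebra_simps)
  finally show ?thesis .
qed

lemma holomorphic_imp_real_analytic_at:
  assumes g: "g holomorphic_on ball w R" and R: "R > 0"
  shows "real_analytic_at (\<lambda>z. Re (g z)) w" "real_analytic_at (\<lambda>z. Im (g z)) w"
proof -
  define a where "a n = (deriv ^^ n) g w / fact n" for n
  define c where "c i j = of_nat ((i + j) choose i) * a (i + j) * \<i> ^ j" for i j
  have sums: "(\<lambda>n. a n * (z - w) ^ n) sums g z" if "z \<in> ball w R" for z
    using holomorphic_power_series[OF g that] by (simp add: a_def)
  have hs: "((\<lambda>(i, j). (Re (z - w) ^ i * Im (z - w) ^ j) *\<^sub>R c i j) has_sum g z) UNIV"
    \<comment> \<open>The radius is halved because |x| + |y| may be as large as 2 |x + iy| in the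
      crude bound, and it has to stay below R.\<close>
    if z: "z \<in> ball w (R / 2)" for z
  proof -
    define \<rho> where "\<rho> = \<bar>Re (z - w)\<bar> + \<bar>Im (z - w)\<bar>"
    have "\<rho> \<le> 2 * norm (z - w)"
      unfolding \<rho>_def using abs_Re_le_cmod[of "z - w"] abs_Im_le_cmod[of "z - w"] by linarith
    then have \<rho>: "0 \<le> \<rho>" "\<rho> < R"
      using z by (auto simp: \<rho>_def dist_norm norm_minus_commute)
    \<comment> \<open>Convergence at a point of larger modulus \<open>\<sigma>\<close> gives
      absolute convergence at \<open>\<rho>\<close>.\<close>
    obtain \<sigma> where \<sigma>: "\<rho> < \<sigma>" "\<sigma> < R" using dense \<rho>(2) by blast
    have "w + of_real \<sigma> \<in> ball w R" using \<sigma> \<rho> by (simp add: dist_norm)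
    from sums[OF this] have "summable (\<lambda>n. a n * of_real \<sigma> ^ n)" by (simp add: sums_iff)
    then have "summable (\<lambda>n. norm (a n * of_real \<rho> ^ n))"
      by (rule powser_insidea) (use \<sigma> \<rho> in simp)
    then have "summable (\<lambda>n. norm (a n) * \<rho> ^ n)"
      using \<rho> by (simp add: norm_mult norm_power)
    moreover have "(\<lambda>n. a n * Complex (Re (z - w)) (Im (z - w)) ^ n) sums g z"
      using sums[of z] z R complex_surj[of "z - w"] by auto
    ultimately show ?thesis
      unfolding \<rho>_def c_def by (rule power_series_double_has_sum)
  qed
  have "((\<lambda>(i, j). (Re (z - w) ^ i * Im (z - w) ^ j) * Re (c i j)) has_sum Re (g z)) UNIV"
    "((\<lambda>(i, j). (Re (z - w) ^ i * Im (z - w) ^ j) * Im (c i j)) has_sum Im (g z)) UNIV"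
    if z: "z \<in> ball w (R / 2)" for z
    using has_sum_bounded_linear[OF bounded_linear_Re hs[OF z]]
      has_sum_bounded_linear[OF bounded_linear_Im hs[OF z]]
    by (simp_all add: o_def case_prod_unfold)
  note series = this
  show "real_analytic_at (\<lambda>z. Re (g z)) w"
    using R series(1) by (intro real_analytic_atI[of "R / 2" w "\<lambda>i j. Re (c i j)"]) simp_all
  show "real_analytic_at (\<lambda>z. Im (g z)) w"
    using R series(2) by (intro real_analytic_atI[of "R / 2" w "\<lambda>i j. Im (c i j)"]) simp_all
qed

text \<open>With \<beta> = Im w and y = Im (z - w), the factor 1 / Im z = 1 / (\<beta> + y) is a
  geometric series in y for |y| < |\<beta>|. The coefficients \<open>d\<close> are those of its
  Cauchy product with the series of h in the variable y.\<close>

lemma real_analytic_at_divide_Im_off_axis: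
  assumes h: "real_analytic_at h w" and R: "R > 0" and w: "Im w \<noteq> 0"
    and eq: "\<And>z. z \<in> ball w R \<Longrightarrow> h z = Im z * k z"
  shows "real_analytic_at k w"
proof -
  define \<beta> where "\<beta> = Im w"
  obtain r c where r: "r > 0" and c: "\<And>z. z \<in> ball w r \<Longrightarrow>
      ((\<lambda>(i, j). (Re (z - w) ^ i * Im (z - w) ^ j) * c i j) has_sum h z) UNIV"
    using h unfolding real_analytic_at_def by blast
  define d where "d i m = (\<Sum>j\<le>m. c i j * (- 1) ^ (m - j) / \<beta> ^ (Suc (m - j)))" for i m
  have "((\<lambda>(i, m). (Re (z - w) ^ i * Im (z - w) ^ m) * d i m) has_sum k z) UNIV"
    if z: "z \<in> ball w (Min {r, R, \<bar>\<beta>\<bar>})" for z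
  proof -
    define x y where "x = Re (z - w)" and "y = Im (z - w)"
    have zr: "z \<in> ball w r" "z \<in> ball w R" and "norm (z - w) < \<bar>\<beta>\<bar>"
      using z by (auto simp: dist_norm norm_minus_commute)
    then have y: "\<bar>y\<bar> < \<bar>\<beta>\<bar>"
      using abs_Im_le_cmod[of "z - w"] by (simp add: y_def)
    have Imz: "Im z = \<beta> + y" by (simp add: y_def \<beta>_def)
    then have Imz0: "Im z \<noteq> 0" using y by linarith
    define A where "A = (\<lambda>(i, j). (x ^ i * y ^ j) * c i j)"
    define G where "G l = (- y) ^ l / \<beta> ^ Suc l" for l
    have A: "(A has_sum h z) UNIV" using c[OF zr(1)] by (simp add: A_def x_def y_def)
    have "norm (- y / \<beta>) < 1" using y w by (simp add: \<beta>_def divide_simps)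
    from geometric_sums[OF this] have "(\<lambda>l. inverse \<beta> * (- y / \<beta>) ^ l) sums (inverse \<beta> * (1 / (1 - - y / \<beta>)))"
      by (rule sums_mult)
    also have "inverse \<beta> * (1 / (1 - - y / \<beta>)) = 1 / Im z"
      using w Imz0 Imz by (simp add: \<beta>_def field_simps)
    also have "(\<lambda>l. inverse \<beta> * (- y / \<beta>) ^ l) = G"
      by (simp only: power_divide) (simp add: G_def fun_eq_iff field_simps)
    finally have G_sums: "G sums (1 / Im z)" .
    have G_norm: "summable (\<lambda>l. norm (G l))"
    proof -
      have "summable (\<lambda>l. inverse \<bar>\<beta>\<bar> * (\<bar>y\<bar> / \<bar>\<beta>\<bar>) ^ l)"
        using y w by (intro summable_mult summable_geometric) (simp add: \<beta>_def divide_simps)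
      moreover have "inverse \<bar>\<beta>\<bar> * (\<bar>y\<bar> / \<bar>\<beta>\<bar>) ^ l = norm (G l)" for l
        by (simp add: G_def power_divide field_simps power_abs abs_mult)
      ultimately show ?thesis by simp
    qed
    have G: "(G has_sum 1 / Im z) UNIV"
      using G_norm G_sums by (rule norm_summable_imp_has_sum)
    have "(\<lambda>l. norm (G l)) summable_on UNIV"
      using G_norm by (intro summable_nonneg_imp_summable_on) auto
    then obtain SG where SG: "((\<lambda>l. norm (G l)) has_sum SG) UNIV" by (auto simp: summable_on_def)
    \<comment> \<open>For real families unconditional summability is already absolute.\<close>
    have A_abs: "(\<lambda>p. norm (A p)) summable_on UNIV"
      using A by (intro summable_on_iff_abs_summable_on_real[THEN iffD1]) (auto simp: summable_on_def)
    have "(\<lambda>q. norm (A (fst q) * G (snd q))) summable_on Sigma UNIV (\<lambda>_. UNIV)"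
    proof (rule summable_on_SigmaI)
      show "((\<lambda>l. norm (A (fst (p, l)) * G (snd (p, l)))) has_sum norm (A p) * SG) UNIV" for p
        using has_sum_cmult_right[OF SG, of "norm (A p)"] by (simp add: abs_mult)
      show "(\<lambda>p. norm (A p) * SG) summable_on UNIV"
        using A_abs by (rule summable_on_cmult_left)
    qed simp
    then have "(\<lambda>q. A (fst q) * G (snd q)) summable_on Sigma UNIV (\<lambda>_. UNIV)"
      by (rule abs_summable_summable)
    moreover have "((\<lambda>l. A (fst (p, l)) * G (snd (p, l))) has_sum A p * (1 / Im z)) UNIV" for p
      using has_sum_cmult_right[OF G, of "A p"] by simp
    moreover have "((\<lambda>p. A p * (1 / Im z)) has_sum h z * (1 / Im z)) UNIV"
      using A by (rule has_sum_cmult_left)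
    ultimately have "((\<lambda>q. A (fst q) * G (snd q)) has_sum h z * (1 / Im z)) (Sigma UNIV (\<lambda>_. UNIV))"
      by (intro has_sum_SigmaI)
    also have "h z * (1 / Im z) = k z"
      using eq[OF zr(2)] Imz0 by simp
    \<comment> \<open>Regrouping by the total exponent m = j + l of y; the inner index j then runs
      up to m.\<close>
    also have "((\<lambda>q. A (fst q) * G (snd q)) has_sum k z) (Sigma UNIV (\<lambda>_. UNIV)) \<longleftrightarrow>
       ((\<lambda>((i, m), j). A (i, j) * G (m - j)) has_sum k z) (Sigma UNIV (\<lambda>(i, m). {..m}))"
      by (rule has_sum_reindex_bij_witness[of _ "\<lambda>((i, m), j). ((i, j), m - j)" "\<lambda>((i, j), l). ((i, j + l), j)"])
        auto
    finally have "((\<lambda>((i, m), j). A (i, j) * G (m - j)) has_sum k z) (Sigma UNIV (\<lambda>(i, m). {..m}))" .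
    moreover have "((\<lambda>j. (\<lambda>((i, m), j). A (i, j) * G (m - j)) (p, j)) has_sum
        (\<lambda>(i, m). (x ^ i * y ^ m) * d i m) p) ((\<lambda>(i, m). {..m}) p)" for p
    proof -
      obtain i m where p: "p = (i, m)" by force
      have "(\<Sum>j\<le>m. A (i, j) * G (m - j)) = (x ^ i * y ^ m) * d i m"
        unfolding d_def sum_distrib_left
      proof (intro sum.cong refl)
        fix j assume "j \<in> {..m}"
        then have ym: "y ^ m = y ^ j * y ^ (m - j)" by (simp flip: power_add)
        have "(- y) ^ (m - j) = (- 1) ^ (m - j) * y ^ (m - j)" by (rule power_minus)
        then show "A (i, j) * G (m - j) = x ^ i * y ^ m * (c i j * (- 1) ^ (m - j) / \<beta> ^ Suc (m - j))"
          by (simp only: A_def G_def prod.case ym times_divide_eq_right mult_ac)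
      qed
      then show ?thesis by (simp add: p has_sum_finite_iff)
    qed
    ultimately have "((\<lambda>(i, m). (x ^ i * y ^ m) * d i m) has_sum k z) UNIV"
      by (rule has_sum_SigmaD)
    then show ?thesis by (simp add: x_def y_def)
  qed
  moreover have "Min {r, R, \<bar>\<beta>\<bar>} > 0" using r R w by (simp add: \<beta>_def)
  ultimately show ?thesis by (intro real_analytic_atI)
qed


text \<open>Since \<open>h\<close> vanishes on the axis, its terms without a factor \<open>Im z\<close> sum to zero. Shifting the
  remaining ones gives \<open>k\<close> off the axis, and on the axis by continuity.\<close>

lemma real_analytic_at_divide_Im_on_axis:
  assumes h: "real_analytic_at h w" and R: "R > 0" and w: "Im w = 0"
    and eq: "\<And>z. z \<in> ball w R \<Longrightarrow> h z = Im z * k z"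
    and cont: "continuous_on (ball w R) k"
  shows "real_analytic_at k w"
proof -
  obtain r c where r: "r > 0" and c: "\<And>z. z \<in> ball w r \<Longrightarrow>
      ((\<lambda>(i, j). (Re (z - w) ^ i * Im (z - w) ^ j) * c i j) has_sum h z) UNIV"
    using h unfolding real_analytic_at_def by blast
  \<comment> \<open>Half the radius, so that |x| and |y| below \<open>\<delta>\<close> keep x + iy
    within both balls.\<close>
  define \<delta> where "\<delta> = min r R / 2"
  have \<delta>: "\<delta> > 0" using r R by (simp add: \<delta>_def)
  define t where "t = (\<lambda>x y (i, j). (x ^ i * y ^ j) * c i (Suc j))"
  have near: "w + Complex x y \<in> ball w r" "w + Complex x y \<in> ball w R"
    if "\<bar>x\<bar> < \<delta>" "\<bar>y\<bar> < \<delta>" for x y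
  proof -
    have "norm (Complex x y) < min r R"
      using cmod_le[of "Complex x y"] that by (simp add: \<delta>_def)
    then show "w + Complex x y \<in> ball w r" "w + Complex x y \<in> ball w R"
      by (simp_all add: dist_norm)
  qed
  have off: "(t x y has_sum k (w + Complex x y)) UNIV"
    if x: "\<bar>x\<bar> < \<delta>" and y: "\<bar>y\<bar> < \<delta>" and y0: "y \<noteq> 0" for x y
  proof -
    define A where "A = (\<lambda>y' (i, j). (x ^ i * y' ^ j) * c i j)"
    have A: "(A y' has_sum h (w + Complex x y')) UNIV" if "\<bar>y'\<bar> < \<delta>" for y'
      using c[OF near(1)[OF x that]] by (simp add: A_def)
    have h0: "h (w + Complex x 0) = 0"
      using eq[OF near(2)[OF x]] \<delta> w by simp
    have "(A 0 has_sum 0) UNIV"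
      using A[of 0] \<delta> h0 by simp
    \<comment> \<open>At y = 0 exactly the terms with j = 0 survive (0^0 = 1), and these do not
      depend on y. So they sum to zero for every y and can be removed before shifting j.\<close>
    also have "?this \<longleftrightarrow> (A y has_sum 0) (range (\<lambda>i. (i, 0)))"
      by (rule has_sum_cong_neutral) (auto simp: A_def image_iff)
    finally have "(A y has_sum h (w + Complex x y) - 0) (UNIV - range (\<lambda>i. (i, 0)))"
      using has_sum_Diff[OF A[OF y]] by blast
    also have "?this \<longleftrightarrow> ((\<lambda>p. y * t x y p) has_sum h (w + Complex x y)) UNIV"
    proof (rule has_sum_reindex_bij_witness[of _ "\<lambda>(i, j). (i, Suc j)" "\<lambda>(i, j). (i, j - 1)"])
      fix p :: "nat \<times> nat" assume "p \<in> UNIV - range (\<lambda>i. (i, 0))"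
      moreover obtain i n where "p = (i, n)" by force
      ultimately obtain j where p: "p = (i, Suc j)" by (cases n) auto
      show "(case case p of (i, j) \<Rightarrow> (i, j - 1) of (i, j) \<Rightarrow> (i, Suc j)) = p"
        "y * t x y (case p of (i, j) \<Rightarrow> (i, j - 1)) = A y p"
        by (simp_all add: p A_def t_def)
    qed auto
    finally have "((\<lambda>p. y * t x y p) has_sum h (w + Complex x y)) UNIV" .
    then have "((\<lambda>p. inverse y * (y * t x y p)) has_sum inverse y * h (w + Complex x y)) UNIV"
      by (rule has_sum_cmult_right)
    moreover have "inverse y * (y * a) = a" for a using y0 by simp
    ultimately show ?thesis
      using y0 eq[OF near(2)[OF x y]] w by simp
  qed
  have on: "(t x 0 has_sum k (w + Complex x 0)) UNIV" if x: "\<bar>x\<bar> < \<delta>" for x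
  proof -
    \<comment> \<open>On this interval the terms are dominated by those at y = \<delta>/2, a
      summable family. Hence the sum is continuous in y; it equals k for y nonzero, and therefore
      also at y = 0.\<close>
    define Y where "Y = {- (\<delta> / 2)..\<delta> / 2}"
    have "t x (\<delta> / 2) summable_on UNIV"
      using off[of x "\<delta> / 2"] x \<delta> by (auto simp: summable_on_def)
    then have summ: "(\<lambda>p. norm (t x (\<delta> / 2) p)) summable_on UNIV"
      by (rule summable_on_iff_abs_summable_on_real[THEN iffD1])
    have bound: "norm (t x y p) \<le> norm (t x (\<delta> / 2) p)" if "y \<in> Y" for y p
    proof -
      obtain i j where p: "p = (i, j)" by force
      have "\<bar>y\<bar> ^ j \<le> \<bar>\<delta> / 2\<bar> ^ j" using that by (intro power_mono) (auto simp: Y_def)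
      then show ?thesis
        by (simp add: p t_def abs_mult power_abs mult_left_mono mult_right_mono)
    qed
    have unif: "uniform_limit Y (\<lambda>F y. \<Sum>p\<in>F. t x y p) (\<lambda>y. infsum (t x y) UNIV) (finite_subsets_at_top UNIV)"
      by (rule Weierstrass_m_test_general[OF bound summ])
    have "continuous_on Y (\<lambda>y. infsum (t x y) UNIV)"
      using unif by (rule uniform_limit_theorem[rotated])
        (auto intro!: always_eventually continuous_intros simp: t_def case_prod_unfold)
    moreover have "continuous_on Y (\<lambda>y. k (w + Complex x y))"
    proof (rule continuous_on_compose2[OF cont])
      show "continuous_on Y (\<lambda>y. w + Complex x y)"
        by (intro continuous_intros continuous_on_Complex)
      show "(\<lambda>y. w + Complex x y) ` Y \<subseteq> ball w R"
        using near(2)[OF x] \<delta> by (force simp: Y_def)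
    qed
    ultimately have "continuous_on Y (\<lambda>y. infsum (t x y) UNIV - k (w + Complex x y))"
      by (rule continuous_on_diff)
    moreover have "closure (Y - {0}) \<subseteq> Y"
      by (rule closure_minimal) (auto simp: Y_def)
    ultimately have "continuous_on (closure (Y - {0})) (\<lambda>y. infsum (t x y) UNIV - k (w + Complex x y))"
      by (rule continuous_on_subset)
    moreover have "infsum (t x y) UNIV - k (w + Complex x y) = 0" if "y \<in> Y - {0}" for y
    proof -
      have "\<bar>y\<bar> < \<delta>" "y \<noteq> 0" using that \<delta> by (auto simp: Y_def)
      then show ?thesis using infsumI[OF off[OF x]] by simp
    qed
    moreover have "0 \<in> closure (Y - {0})"
    proof -
      have "0 islimpt Y" using \<delta> by (simp add: Y_def islimpt_Icc)
      then show ?thesis by (simp add: islimpt_in_closure)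
    qed
    ultimately have "infsum (t x 0) UNIV - k (w + Complex x 0) = 0"
      by (rule continuous_constant_on_closure)
    moreover have "t x 0 summable_on UNIV"
    proof -
      have "0 \<in> Y" using \<delta> by (simp add: Y_def)
      have "(\<lambda>p. norm (t x 0 p)) summable_on UNIV"
        by (rule summable_on_comparison_test[where f = "\<lambda>p. norm (t x (\<delta> / 2) p)"])
          (use bound[OF \<open>0 \<in> Y\<close>] summ in auto)
      then show ?thesis by (rule abs_summable_summable)
    qed
    ultimately show ?thesis using has_sum_infsum[of "t x 0" UNIV] by simp
  qed
  have "((\<lambda>(i, j). (Re (z - w) ^ i * Im (z - w) ^ j) * c i (Suc j)) has_sum k z) UNIV"
    if z: "z \<in> ball w \<delta>" for z
  proof -
    have "\<bar>Re (z - w)\<bar> < \<delta>" "\<bar>Im (z - w)\<bar> < \<delta>"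
      using z abs_Re_le_cmod[of "z - w"] abs_Im_le_cmod[of "z - w"] by (auto simp: dist_norm norm_minus_commute)
    then have "(t (Re (z - w)) (Im (z - w)) has_sum k (w + Complex (Re (z - w)) (Im (z - w)))) UNIV"
      using on[of "Re (z - w)"] off[of "Re (z - w)" "Im (z - w)"] by (cases "Im (z - w) = 0") auto
    then show ?thesis by (simp only: t_def complex_surj) simp
  qed
  then show ?thesis
    by (intro real_analytic_atI[OF \<delta>])
qed

lemma real_analytic_at_divide_Im:
  assumes "real_analytic_at h w" and "R > 0"
    and "\<And>z. z \<in> ball w R \<Longrightarrow> h z = Im z * k z"
    and "continuous_on (ball w R) k"
  shows "real_analytic_at k w"
proof (cases "Im w = 0")
  case True
  show ?thesis by (rule real_analytic_at_divide_Im_on_axis[OF assms(1,2) True assms(3,4)])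
next
  case False
  show ?thesis by (rule real_analytic_at_divide_Im_off_axis[OF assms(1,2) False assms(3)])
qed

section \<open>Analyticity of solutions of the Bers-Vekua system\<close>

text \<open>Poincare lemma for the form -u da + v db, which is closed by the second Bers-Vekua
  equation. The potential is the integral along the segment from the centre, differentiated under
  the integral sign; this is where continuity of the partial derivatives enters.\<close>

lemma radial_potential:
  fixes u v :: "complex \<Rightarrow> real"
  assumes u: "\<And>z. z \<in> ball w R \<Longrightarrow> (u has_derivative (\<lambda>h. Re h * ua z + Im h * ub z)) (at z)"
    and v: "\<And>z. z \<in> ball w R \<Longrightarrow> (v has_derivative (\<lambda>h. Re h * va z + Im h * vb z)) (at z)"
    and cont: "continuous_on (ball w R) ua" "continuous_on (ball w R) ub"
      "continuous_on (ball w R) va" "continuous_on (ball w R) vb"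
    and closed: "\<And>z. z \<in> ball w R \<Longrightarrow> va z = - ub z"
  shows "\<exists>s. \<forall>z\<in>ball w R. (s has_derivative (\<lambda>h. - u z * Re h + v z * Im h)) (at z)"
proof (cases "R > 0")
  case True
  define pt where "pt z t = w + of_real t * (z - w)" for z :: complex and t :: real
  \<comment> \<open>Re and Im as elements of the space of bounded linear maps, so that F' has the
    type required by \<open>leibniz_rule\<close>.\<close>
  define re_bl im_bl :: "complex \<Rightarrow>\<^sub>L real" where "re_bl = Blinfun Re" and "im_bl = Blinfun Im"
  have bl [simp]: "blinfun_apply re_bl h = Re h" "blinfun_apply im_bl h = Im h" for h
    by (simp_all add: re_bl_def im_bl_def bounded_linear_Blinfun_apply bounded_linear_Re bounded_linear_Im)
  define F where "F z t = - u (pt z t) * Re (z - w) + v (pt z t) * Im (z - w)" for z t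
  define F' where "F' z t =
     (- u (pt z t) - t * Re (z - w) * ua (pt z t) + t * Im (z - w) * va (pt z t)) *\<^sub>R re_bl
      + (v (pt z t) - t * Re (z - w) * ub (pt z t) + t * Im (z - w) * vb (pt z t)) *\<^sub>R im_bl" for z t
  have pt: "pt z t \<in> ball w R" if "z \<in> ball w R" "t \<in> cbox 0 1" for z t
  proof -
    have "norm (pt z t - w) = \<bar>t\<bar> * norm (z - w)" by (simp add: pt_def norm_mult)
    also have "\<dots> \<le> 1 * norm (z - w)" using that by (intro mult_right_mono) auto
    finally show ?thesis using that by (simp add: dist_norm norm_minus_commute)
  qed
  have cont_uv: "continuous_on (ball w R) u" "continuous_on (ball w R) v"
    using u v by (meson continuous_at_imp_continuous_on has_derivative_continuous)+
  have pt_cont: "continuous_on A (\<lambda>q. pt (g q) (h q))" if "continuous_on A g" "continuous_on A h" for A g h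
    unfolding pt_def using that by (intro continuous_intros)
  have deriv: "((\<lambda>z. F z t) has_derivative blinfun_apply (F' z t)) (at z within ball w R)"
    if z: "z \<in> ball w R" and t: "t \<in> cbox 0 1" for z t
  proof -
    have p: "((\<lambda>z. pt z t) has_derivative (\<lambda>h. of_real t * h)) (at z)"
      unfolding pt_def by (auto intro!: derivative_eq_intros)
    note up = has_derivative_compose[OF p u[OF pt[OF z t]]]
    note vp = has_derivative_compose[OF p v[OF pt[OF z t]]]
    show ?thesis
      unfolding F_def
      by (rule has_derivative_at_withinI)
        (auto intro!: derivative_eq_intros up vp simp: F'_def blinfun.bilinear_simps algebra_simps)
  qed
  have ftc: "((\<lambda>t. blinfun_apply (F' z t) h) has_integral (- u z * Re h + v z * Im h)) {0..1}"
    if z: "z \<in> ball w R" for z h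
  proof -
    \<comment> \<open>By closedness, the z-derivative of the integrand in direction h is the
      t-derivative of G, so its integral is the form at the endpoint z.\<close>
    define G where "G t = t * (- u (pt z t) * Re h + v (pt z t) * Im h)" for t
    have "(G has_vector_derivative blinfun_apply (F' z t) h) (at t within {0..1})" if t: "t \<in> {0..1}" for t
    proof -
      have t': "t \<in> cbox 0 1" using t by simp
      have p: "((\<lambda>t. pt z t) has_derivative (\<lambda>h. of_real h * (z - w))) (at t)"
        unfolding pt_def by (auto intro!: derivative_eq_intros)
      note up = has_derivative_compose[OF p u[OF pt[OF z t']]]
      note vp = has_derivative_compose[OF p v[OF pt[OF z t']]]
      show ?thesis
        unfolding G_def has_vector_derivative_def
        by (rule has_derivative_at_withinI)
          (auto intro!: derivative_eq_intros up vp
            simp: F'_def blinfun.bilinear_simps closed[OF pt[OF z t']] algebra_simps)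
    qed
    then have "((\<lambda>t. blinfun_apply (F' z t) h) has_integral (G 1 - G 0)) {0..1}"
      by (intro fundamental_theorem_of_calculus) auto
    then show ?thesis by (simp add: G_def pt_def)
  qed
  have F_int: "F z integrable_on cbox 0 1" if z: "z \<in> ball w R" for z
    unfolding F_def
    by (intro integrable_continuous continuous_intros
        continuous_on_compose2[OF cont_uv(1)] continuous_on_compose2[OF cont_uv(2)] pt_cont)
      (use pt z in auto)
  have F'_cont: "continuous_on (ball w R \<times> cbox 0 1) (\<lambda>(z, t). F' z t)"
    unfolding F'_def case_prod_unfold
    by (intro continuous_intros pt_cont
        continuous_on_compose2[OF cont_uv(1)] continuous_on_compose2[OF cont_uv(2)]
        continuous_on_compose2[OF cont(1)] continuous_on_compose2[OF cont(2)]
        continuous_on_compose2[OF cont(3)] continuous_on_compose2[OF cont(4)])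
      (use pt in auto)
  have "((\<lambda>z. integral (cbox 0 1) (F z)) has_derivative (\<lambda>h. - u z * Re h + v z * Im h)) (at z)"
    if z: "z \<in> ball w R" for z
  proof -
    have "((\<lambda>z. integral (cbox 0 1) (F z)) has_derivative blinfun_apply (integral (cbox 0 1) (F' z))) (at z within ball w R)"
      using deriv F_int F'_cont z by (rule leibniz_rule) auto
    moreover have "blinfun_apply (integral (cbox 0 1) (F' z)) = (\<lambda>h. - u z * Re h + v z * Im h)"
    proof
      fix h
      have "continuous_on (cbox 0 1) (F' z)"
        by (rule continuous_on_compose2[OF F'_cont, of _ "\<lambda>t. (z, t)", simplified])
          (use z in \<open>auto intro!: continuous_intros\<close>)
      then have "F' z integrable_on cbox 0 1" by (rule integrable_continuous)
      then have "blinfun_apply (integral (cbox 0 1) (F' z)) h = integral (cbox 0 1) (\<lambda>t. blinfun_apply (F' z t) h)"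
        by (rule blinfun_apply_integral)
      also have "\<dots> = - u z * Re h + v z * Im h"
        using integral_unique[OF ftc[OF z, of h]] by simp
      finally show "blinfun_apply (integral (cbox 0 1) (F' z)) h = - u z * Re h + v z * Im h" .
    qed
    ultimately show ?thesis using z by (simp add: at_within_open[OF z open_ball])
  qed
  then show ?thesis by blast
next
  case False
  then have "ball w R = {}" by simp
  then show ?thesis by blast
qed

text \<open>The ball may meet the real axis. The form of \<open>bv1\<close> multiplied by Im z is
  meaningful there, and all three divisions by Im z have continuous quotients s, u and v.\<close>

lemma bers_vekua_imp_real_analytic_at:
  fixes u v :: "complex \<Rightarrow> real"
  assumes R: "R > 0"
    and u: "\<And>z. z \<in> ball w R \<Longrightarrow> (u has_derivative (\<lambda>h. Re h * ua z + Im h * ub z)) (at z)"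
    and v: "\<And>z. z \<in> ball w R \<Longrightarrow> (v has_derivative (\<lambda>h. Re h * va z + Im h * vb z)) (at z)"
    and cont: "continuous_on (ball w R) ua" "continuous_on (ball w R) ub"
      "continuous_on (ball w R) va" "continuous_on (ball w R) vb"
    and bv1: "\<And>z. z \<in> ball w R \<Longrightarrow> Im z * (ua z - vb z) = 2 * v z"
    and bv2: "\<And>z. z \<in> ball w R \<Longrightarrow> ub z + va z = 0"
  shows "real_analytic_at u w" "real_analytic_at v w"
proof -
  have va: "va z = - ub z" if "z \<in> ball w R" for z using bv2[OF that] by simp
  obtain s where s: "\<And>z. z \<in> ball w R \<Longrightarrow> (s has_derivative (\<lambda>h. - u z * Re h + v z * Im h)) (at z)"
    using radial_potential[OF u v cont va] by blast
  define g where "g z = Complex (s z + Im z * v z) (- (Im z * u z))" for z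
  have g: "(g has_field_derivative Complex (- u z + Im z * va z) (- (Im z * ua z))) (at z)"
    if z: "z \<in> ball w R" for z
  proof -
    have "((\<lambda>z. of_real (s z + Im z * v z) + \<i> * of_real (- (Im z * u z))) has_derivative
        (\<lambda>h. of_real ((- u z * Re h + v z * Im h) + (Im h * v z + Im z * (Re h * va z + Im h * vb z)))
          + \<i> * of_real (- (Im h * u z + Im z * (Re h * ua z + Im h * ub z))))) (at z)"
      by (auto intro!: derivative_eq_intros s[OF z] u[OF z] v[OF z] simp: algebra_simps)
    also have "(\<lambda>z. of_real (s z + Im z * v z) + \<i> * of_real (- (Im z * u z))) = g"
      by (auto simp: g_def Complex_eq)
    also have "(\<lambda>h. of_real ((- u z * Re h + v z * Im h) + (Im h * v z + Im z * (Re h * va z + Im h * vb z)))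
          + \<i> * of_real (- (Im h * u z + Im z * (Re h * ua z + Im h * ub z)))) =
        (*) (Complex (- u z + Im z * va z) (- (Im z * ua z)))"
    proof
      fix h
      \<comment> \<open>The Cauchy-Riemann equations of g = (s + b v) - i b u are the given system:
        \<open>bv1\<close> compares the b-derivative of the real part with the a-derivative of the
        imaginary part, \<open>bv2\<close> gives the other pair.\<close>
      have "Im z * ua z = 2 * v z + Im z * vb z" using bv1[OF z] by (simp add: algebra_simps)
      then have "Im h * (Im z * ua z) = Im h * (2 * v z + Im z * vb z)" by simp
      then show "of_real ((- u z * Re h + v z * Im h) + (Im h * v z + Im z * (Re h * va z + Im h * vb z)))
          + \<i> * of_real (- (Im h * u z + Im z * (Re h * ua z + Im h * ub z))) =
        Complex (- u z + Im z * va z) (- (Im z * ua z)) * h"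
        by (simp add: complex_eq_iff va[OF z] algebra_simps)
    qed
    finally show ?thesis by (simp add: has_field_derivative_def)
  qed
  have g_hol: "g holomorphic_on ball w R"
    using g by (meson field_differentiable_at_within field_differentiable_def holomorphic_on_def)
  obtain F where F: "\<And>z. z \<in> ball w R \<Longrightarrow> (F has_field_derivative g z) (at z)"
    using holomorphic_convex_primitive'[OF convex_ball open_ball g_hol]
    by (auto simp: at_within_open[OF _ open_ball])
  have F_hol: "F holomorphic_on ball w R"
    using F by (meson field_differentiable_at_within field_differentiable_def holomorphic_on_def)
  have "((\<lambda>z. Im (F z) - Im z * s z) has_derivative (\<lambda>h. 0)) (at z within ball w R)"
    if z: "z \<in> ball w R" for z
  proof -
    have F': "(F has_derivative (*) (g z)) (at z)" using F[OF z] by (simp add: has_field_derivative_def)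
    have "((\<lambda>z. Im (F z) - Im z * s z) has_derivative
       (\<lambda>h. Im (g z * h) - (Im h * s z + Im z * (- u z * Re h + v z * Im h)))) (at z)"
      by (auto intro!: derivative_eq_intros F' s[OF z] simp: algebra_simps)
    moreover have "(\<lambda>h. Im (g z * h) - (Im h * s z + Im z * (- u z * Re h + v z * Im h))) = (\<lambda>h. 0)"
      by (auto simp: g_def algebra_simps)
    ultimately show ?thesis by (simp add: has_derivative_at_withinI)
  qed
  then obtain C where C: "\<And>z. z \<in> ball w R \<Longrightarrow> Im (F z) - Im z * s z = C"
    using has_derivative_zero_constant[of "ball w R" "\<lambda>z. Im (F z) - Im z * s z"] by auto
  \<comment> \<open>Im F agrees with b s only up to a constant; after this correction it vanishes on
    the axis, as division by Im z demands.\<close>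
  define F1 where "F1 z = F z - \<i> * of_real C" for z
  have F1_hol: "F1 holomorphic_on ball w R"
    unfolding F1_def by (intro holomorphic_intros F_hol)
  have cont_suv: "continuous_on (ball w R) s" "continuous_on (ball w R) u" "continuous_on (ball w R) v"
    using s u v by (meson continuous_at_imp_continuous_on has_derivative_continuous)+
  note g_ra = holomorphic_imp_real_analytic_at[OF g_hol R]
  have s_ra: "real_analytic_at s w"
  proof (rule real_analytic_at_divide_Im[OF holomorphic_imp_real_analytic_at(2)[OF F1_hol R] R _ cont_suv(1)])
    show "Im (F1 z) = Im z * s z" if "z \<in> ball w R" for z using C[OF that] by (simp add: F1_def)
  qed
  show "real_analytic_at u w"
    by (rule real_analytic_at_divide_Im[OF real_analytic_at_minus[OF g_ra(2)] R _ cont_suv(2)])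
      (simp add: g_def)
  show "real_analytic_at v w"
    by (rule real_analytic_at_divide_Im[OF real_analytic_at_diff[OF g_ra(1) s_ra] R _ cont_suv(3)])
      (simp add: g_def)
qed

section \<open>The system for local stem functions and the continuation\<close>

lemma oct_partial_eq:
  assumes "(f has_derivative f') (at x)"
  shows "oct_partial l f x = f' (\<e> l)"
proof -
  interpret f': bounded_linear f' using assms by (rule has_derivative_bounded_linear)
  have line: "((\<lambda>t. x + t *\<^sub>R \<e> l) has_derivative (\<lambda>t. t *\<^sub>R \<e> l)) (at 0)"
    by (auto intro!: derivative_eq_intros)
  have "(f has_derivative f') (at (x + 0 *\<^sub>R \<e> l))" using assms by simp
  from has_derivative_compose[OF line this]
  have "((\<lambda>t. f (x + t *\<^sub>R \<e> l)) has_vector_derivative f' (\<e> l)) (at 0)"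
    by (simp add: has_vector_derivative_def f'.scaleR)
  then show ?thesis by (simp add: oct_partial_def vector_derivative_at)
qed

text \<open>L_mn differentiates in the direction x_m e_n - x_n e_m, which is tangential to the
  sphere around the real axis, so f' acts as T v. The Clifford relations reduce each summand to
  -(x_m e_m v + x_n e_n v), and every index occurs in six pairs.\<close>

lemma oct_Gamma_tangential:
  assumes f': "(f has_derivative f') (at x)"
    and tangential: "\<And>T. T $ 0 = 0 \<Longrightarrow> T \<bullet> oct_Im x = 0 \<Longrightarrow> f' T = T \<odot> v"
  shows "oct_Gamma f x = 6 *\<^sub>R (oct_Im x \<odot> v)"
proof -
  interpret f': bounded_linear f' using f' by (rule has_derivative_bounded_linear)
  have *: "\<e> m \<odot> (\<e> n \<odot> oct_L m n f x) = - (x $ m *\<^sub>R (\<e> m \<odot> v) + x $ n *\<^sub>R (\<e> n \<odot> v))"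
    if mn: "m \<noteq> 0" "n \<noteq> 0" "m \<noteq> n" for m n
  proof -
    have "oct_L m n f x = f' (x $ m *\<^sub>R \<e> n - x $ n *\<^sub>R \<e> m)"
      by (simp add: oct_L_def oct_partial_eq[OF f'] f'.diff f'.scaleR)
    also have "\<dots> = (x $ m *\<^sub>R \<e> n - x $ n *\<^sub>R \<e> m) \<odot> v"
      using mn by (intro tangential) (simp_all add: oct_basis_nth inner_diff_left oct_basis_inner oct_Im_nth)
    finally have "oct_L m n f x = x $ m *\<^sub>R (\<e> n \<odot> v) - x $ n *\<^sub>R (\<e> m \<odot> v)"
      by (simp add: oct.diff_left oct.scaleR_left)
    then show ?thesis
      using mn by (simp add: oct.diff_right oct.scaleR_right oct_basis_mult_twice oct_basis_mult_thrice oct.minus_right)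
  qed
  have "(\<Sum>(m, n) \<in> {(m, n). 1 \<le> m \<and> m < n \<and> n \<le> 7}. \<e> m \<odot> (\<e> n \<odot> oct_L m n f x)) =
      (\<Sum>(m, n) \<in> {(m, n). 1 \<le> m \<and> m < n \<and> n \<le> 7}. - (x $ m *\<^sub>R (\<e> m \<odot> v) + x $ n *\<^sub>R (\<e> n \<odot> v)))"
  proof (rule sum.cong[OF refl])
    fix p :: "8 \<times> 8" assume p: "p \<in> {(m, n). 1 \<le> m \<and> m < n \<and> n \<le> 7}"
    obtain m n where mn: "p = (m, n)" by force
    with p have "m \<in> {1..7}" "n \<in> {1..7}" "m \<noteq> n" by auto
    then have "m \<noteq> 0" "n \<noteq> 0" "m \<noteq> n" by (simp_all only: index_1_7) auto
    from *[OF this] mn show "(case p of (m, n) \<Rightarrow> \<e> m \<odot> (\<e> n \<odot> oct_L m n f x)) =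
        (case p of (m, n) \<Rightarrow> - (x $ m *\<^sub>R (\<e> m \<odot> v) + x $ n *\<^sub>R (\<e> n \<odot> v)))"
      by simp
  qed
  also have "\<dots> = - (\<Sum>(m, n) \<in> {(m, n). 1 \<le> m \<and> m < n \<and> n \<le> 7}. x $ m *\<^sub>R (\<e> m \<odot> v) + x $ n *\<^sub>R (\<e> n \<odot> v))"
    by (simp only: case_prod_unfold sum_negf)
  also have "\<dots> = - (6 *\<^sub>R (\<Sum>l\<in>UNIV - {0}. x $ l *\<^sub>R (\<e> l \<odot> v)))"
    using sum_index_pairs_8[of "\<lambda>l. x $ l *\<^sub>R (\<e> l \<odot> v)"] by (simp only:)
  also have "(\<Sum>l\<in>UNIV - {0}. x $ l *\<^sub>R (\<e> l \<odot> v)) = oct_Im x \<odot> v"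
    by (simp only: oct_Im_def oct.sum_left oct.scaleR_left)
  finally show ?thesis by (simp only: oct_Gamma_def minus_minus)
qed

lemma oct_Euler_eq:
  assumes "(f has_derivative f') (at x)"
  shows "oct_Euler f x = f' (oct_Im x)"
proof -
  interpret f': bounded_linear f' using assms by (rule has_derivative_bounded_linear)
  show ?thesis
    by (simp only: oct_Euler_def oct_Im_def index_1_7 oct_partial_eq[OF assms] f'.sum f'.scaleR)
qed

text \<open>With \<beta> = Im w, Im(x) = \<beta> K has inverse -K/\<beta>. So the Euler term becomes
  K f'(K), while \<Gamma> f = 6 K v yields (6/3) K (K v) / \<beta> = -2v/\<beta>.\<close>

lemma slice_fueter_op_tangential:
  assumes f': "(f has_derivative f') (at (\<tau> K w))"
    and K: "K \<in> \<SS>" and w: "Im w \<noteq> 0"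
    and tangential: "\<And>T. T \<in> \<SS> \<Longrightarrow> T \<bullet> K = 0 \<Longrightarrow> Im w *\<^sub>R f' T = T \<odot> v"
  shows "slice_fueter_op f (\<tau> K w) = f' (\<e> 0) + K \<odot> f' K - (2 / Im w) *\<^sub>R v"
proof -
  interpret f': bounded_linear f' using f' by (rule has_derivative_bounded_linear)
  define \<beta> where "\<beta> = Im w"
  have Im: "oct_Im (\<tau> K w) = \<beta> *\<^sub>R K"
    using K by (simp add: oct_Im_eq slice_embed_nth_0 \<beta>_def) (simp add: slice_embed_def)
  have "norm K = 1" "K $ 0 = 0" using K by (simp_all add: imag_units_iff)
  then have inv: "oct_inverse (\<beta> *\<^sub>R K) = - (1 / \<beta>) *\<^sub>R K"
    by (simp add: oct_inverse_def oct_Re_def oct_Im_eq power2_eq_square)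
  have "f' T = T \<odot> (v /\<^sub>R \<beta>)" if T: "T $ 0 = 0" "T \<bullet> oct_Im (\<tau> K w) = 0" for T
  proof (cases "T = 0")
    case True
    then show ?thesis by (simp add: f'.zero oct.zero_left)
  next
    case False
    have "T /\<^sub>R norm T \<in> \<SS>" "(T /\<^sub>R norm T) \<bullet> K = 0"
      using T False w by (simp_all add: imag_units_iff Im \<beta>_def)
    from tangential[OF this] have "inverse (norm T) *\<^sub>R (\<beta> *\<^sub>R f' T) = inverse (norm T) *\<^sub>R (T \<odot> v)"
      by (simp add: \<beta>_def f'.scaleR oct.scaleR_left mult.commute)
    then have "\<beta> *\<^sub>R f' T = T \<odot> v" using False by (simp only: scaleR_cancel_left) simp
    then have "f' T = (T \<odot> v) /\<^sub>R \<beta>" using w by (metis \<beta>_def scaleR_left_imp_eq divideR_right)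
    then show ?thesis by (simp add: oct.scaleR_right)
  qed
  from oct_Gamma_tangential[OF f' this]
  have "oct_Gamma f (\<tau> K w) = 6 *\<^sub>R (K \<odot> v)"
    using w by (simp add: Im \<beta>_def oct.scaleR_left oct.scaleR_right)
  moreover have "\<beta> \<noteq> 0" using w by (simp add: \<beta>_def)
  ultimately show ?thesis
    using K by (simp add: slice_fueter_op_def oct_partial_eq[OF f'] oct_Euler_eq[OF f'] Im inv f'.scaleR
        oct.scaleR_left oct.scaleR_right oct.minus_left imag_units_mult_mult flip: \<beta>_def)
qed

text \<open>Differentiate f along the great circle through K with velocity T in two ways: by the
  chain rule, and through f = u + J v with u and v fixed, which holds near K since B is
  open.\<close>

lemma stem_tangential_derivative:
  assumes f': "(f has_derivative f') (at (\<tau> K w))"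
    and B: "open B" "\<tau> K w \<in> B"
    and uv: "\<And>J. J \<in> \<SS> \<Longrightarrow> \<tau> J w \<in> B \<Longrightarrow> f (\<tau> J w) = u + J \<odot> v"
    and K: "K \<in> \<SS>" and T: "T \<in> \<SS>" "T \<bullet> K = 0"
  shows "Im w *\<^sub>R f' T = T \<odot> v"
proof -
  interpret f': bounded_linear f' using f' by (rule has_derivative_bounded_linear)
  define c where "c t = cos t *\<^sub>R K + sin t *\<^sub>R T" for t :: real
  have c0: "c 0 = K" by (simp add: c_def)
  have c: "c t \<in> \<SS>" for t
    unfolding c_def using K T by (intro great_circle_in_imag_units) (simp_all add: inner_commute)
  have c': "(c has_vector_derivative T) (at 0)"
    unfolding c_def by (auto intro!: derivative_eq_intros)
  have "((\<lambda>t. \<tau> (c t) w) has_vector_derivative Im w *\<^sub>R T) (at 0)"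
    unfolding slice_embed_def by (auto intro!: derivative_eq_intros c')
  then have "((\<lambda>t. f (\<tau> (c t) w)) has_derivative (\<lambda>t. f' (t *\<^sub>R (Im w *\<^sub>R T)))) (at 0)"
    using f' unfolding has_vector_derivative_def c0[symmetric] by (rule has_derivative_compose)
  then have lhs: "((\<lambda>t. f (\<tau> (c t) w)) has_vector_derivative Im w *\<^sub>R f' T) (at 0)"
    by (simp add: has_vector_derivative_def f'.scaleR)
  have rhs: "((\<lambda>t. u + c t \<odot> v) has_vector_derivative T \<odot> v) (at 0)"
    using bounded_linear.has_vector_derivative[OF oct.bounded_linear_left c', of v]
    by (auto intro!: derivative_eq_intros)
  have "isCont (\<lambda>t. \<tau> (c t) w) 0"
    unfolding slice_embed_def c_def by (intro continuous_intros)
  then have "((\<lambda>t. \<tau> (c t) w) \<longlongrightarrow> \<tau> (c 0) w) (nhds 0)"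
    using tendsto_at_iff_tendsto_nhds[of "\<lambda>t. \<tau> (c t) w" 0] by (simp only: isCont_def)
  then have "\<forall>\<^sub>F t in nhds 0. \<tau> (c t) w \<in> B"
    using B c0 by (intro topological_tendstoD) simp_all
  then have "\<forall>\<^sub>F t in nhds 0. f (\<tau> (c t) w) = u + c t \<odot> v"
    by eventually_elim (simp add: uv c)
  then have "((\<lambda>t. f (\<tau> (c t) w)) has_vector_derivative T \<odot> v) (at 0) \<longleftrightarrow>
      ((\<lambda>t. u + c t \<odot> v) has_vector_derivative T \<odot> v) (at 0)"
    by (intro has_vector_derivative_cong_ev)
      (auto dest: eventually_nhds_x_imp_x elim: eventually_mono)
  with rhs have "((\<lambda>t. f (\<tau> (c t) w)) has_vector_derivative T \<odot> v) (at 0)" by simp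
  with lhs show ?thesis by (rule vector_derivative_unique_at)
qed

text \<open>A second unit J so close to I that both slices over a common disc N stay in B turns u
  and v into fixed linear expressions in two restrictions of f, which carry over its C^1
  regularity.\<close>

lemma local_stem_C1_system:
  assumes \<Omega>: "open \<Omega>" and f: "slice_fueter_regular \<Omega> f" and B: "open_ball_in \<Omega> B"
    and I: "I \<in> \<SS>" "\<tau> I z \<in> B"
  defines "u \<equiv> fst (local_stem \<Omega> f B)" and "v \<equiv> snd (local_stem \<Omega> f B)"
  shows "\<exists>R ua ub va vb. R > 0 \<and> (\<forall>w\<in>ball z R. \<tau> I w \<in> B \<and>
      (u has_derivative (\<lambda>h. Re h *\<^sub>R ua w + Im h *\<^sub>R ub w)) (at w) \<and>
      (v has_derivative (\<lambda>h. Re h *\<^sub>R va w + Im h *\<^sub>R vb w)) (at w) \<and>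
      Im w *\<^sub>R (ua w - vb w) = 2 *\<^sub>R v w \<and> ub w + va w = 0) \<and>
      continuous_on (ball z R) ua \<and> continuous_on (ball z R) ub \<and>
      continuous_on (ball z R) va \<and> continuous_on (ball z R) vb"
proof -
  have slice: "slice_function \<Omega> f" using f by (simp add: slice_fueter_regular_def)
  obtain f' :: "octonion \<Rightarrow> octonion \<Rightarrow>\<^sub>L octonion"
    where f': "\<And>x. x \<in> \<Omega> \<Longrightarrow> (f has_derivative blinfun_apply (f' x)) (at x)" and f'_cont: "continuous_on \<Omega> f'"
    using f by (auto simp: slice_fueter_regular_def C1_on_def)
  have B_open: "open B" and B_sub: "B \<subseteq> \<Omega>" using B by (auto simp: open_ball_in_def)
  have uv: "f (\<tau> K w) = u w + K \<odot> v w" if "K \<in> \<SS>" "\<tau> K w \<in> B" for K w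
    using local_stem_value_eq(2)[OF \<Omega> slice B that] by (simp add: u_def v_def local_stem_def)
  obtain r where r: "r > 0" "ball (\<tau> I z) r \<subseteq> B" using B_open I openE by blast
  define N where "N = ball z (r / 2)"
  \<comment> \<open>Changing the unit moves a point by |Im z| times the distance of the units; this
    bound keeps the move below r/2, and the summand 1 covers real z.\<close>
  have "r / (2 * (\<bar>Im z\<bar> + 1)) > 0" using r by simp
  then obtain J where J: "J \<in> \<SS>" "J \<noteq> I" "dist I J < r / (2 * (\<bar>Im z\<bar> + 1))"
    using ex_nearby_imag_unit[OF I(1)] by blast
  have in_B: "\<tau> I w \<in> B" "\<tau> J w \<in> B" if w: "w \<in> N" for w
  proof -
    have d: "dist (\<tau> I z) (\<tau> I w) < r / 2" "dist (\<tau> J z) (\<tau> J w) < r / 2"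
      using w I J by (simp_all add: dist_slice_embed N_def)
    have "dist (\<tau> I z) (\<tau> J z) \<le> (\<bar>Im z\<bar> + 1) * dist I J"
      by (simp add: dist_slice_embed_units algebra_simps)
    also have "\<dots> < r / 2"
      using J(3) by (simp add: field_simps)
    finally have "dist (\<tau> I z) (\<tau> J w) < r" using d dist_triangle[of "\<tau> I z" "\<tau> J w" "\<tau> J z"] by simp
    with d r show "\<tau> I w \<in> B" "\<tau> J w \<in> B" by (auto simp: subset_iff)
  qed
  define D where "D = I - J"
  have D: "D $ 0 = 0" "D \<bullet> D \<noteq> 0" using I J by (simp_all add: D_def imag_units_iff)
  \<comment> \<open>Inverse of left multiplication by D = I - J, read off from D (D y) = -|D|^2
    y.\<close>
  define divD where "divD y = - (1 / (D \<bullet> D)) *\<^sub>R (D \<odot> y)" for y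
  have divD: "divD (D \<odot> y) = y" "D \<odot> divD y = y" for y
    using D by (simp_all add: divD_def oct_imag_mult_mult oct.scaleR_right oct.minus_right)
  have divD_lin: "bounded_linear divD"
    unfolding divD_def by (intro bounded_linear_const_scaleR oct.bounded_linear_right)
  interpret divD: bounded_linear divD by (rule divD_lin)
  define fa where "fa K w = blinfun_apply (f' (\<tau> K w)) (\<e> 0)" for K w
  define fb where "fb K w = blinfun_apply (f' (\<tau> K w)) K" for K w
  \<comment> \<open>The candidates solve fa K = ua + K va and fb K = ub + K vb for K = I and K = J,
    just as u and v do for f.\<close>
  define va where "va w = divD (fa I w - fa J w)" for w
  define vb where "vb w = divD (fb I w - fb J w)" for w
  define ua where "ua w = fa I w - I \<odot> va w" for w
  define ub where "ub w = fb I w - I \<odot> vb w" for w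
  have f_deriv: "((\<lambda>w. f (\<tau> K w)) has_derivative (\<lambda>h. Re h *\<^sub>R fa K w + Im h *\<^sub>R fb K w)) (at w)"
    if "\<tau> K w \<in> B" for K w
  proof -
    have "((\<lambda>w. \<tau> K w) has_derivative (\<lambda>h. \<tau> K h)) (at w)"
      unfolding slice_embed_def by (auto intro!: derivative_eq_intros)
    moreover have "(f has_derivative blinfun_apply (f' (\<tau> K w))) (at (\<tau> K w))"
      using that B_sub by (intro f') auto
    ultimately have "((\<lambda>w. f (\<tau> K w)) has_derivative (\<lambda>h. blinfun_apply (f' (\<tau> K w)) (\<tau> K h))) (at w)"
      by (rule has_derivative_compose)
    then show ?thesis by (simp add: slice_embed_def fa_def fb_def blinfun.bilinear_simps)
  qed
  have fab: "fa I w = ua w + I \<odot> va w" "fb I w = ub w + I \<odot> vb w"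
    "fa J w = ua w + J \<odot> va w" "fb J w = ub w + J \<odot> vb w" for w
  proof -
    show "fa I w = ua w + I \<odot> va w" "fb I w = ub w + I \<odot> vb w" by (simp_all add: ua_def ub_def)
    have "(I - J) \<odot> va w = fa I w - fa J w" "(I - J) \<odot> vb w = fb I w - fb J w"
      using divD(2) by (simp_all add: va_def vb_def D_def)
    then show "fa J w = ua w + J \<odot> va w" "fb J w = ub w + J \<odot> vb w"
      by (simp_all add: ua_def ub_def oct.diff_left algebra_simps)
  qed
  have v_eq: "v w = divD (f (\<tau> I w) - f (\<tau> J w))" if "w \<in> N" for w
  proof -
    have "f (\<tau> I w) - f (\<tau> J w) = D \<odot> v w"
      using uv I J in_B[OF that] by (simp add: D_def oct.diff_left)
    then show ?thesis by (simp add: divD)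
  qed
  have u_eq: "u w = f (\<tau> I w) - I \<odot> v w" if "w \<in> N" for w
    using uv I in_B[OF that] by simp
  have v_deriv: "(v has_derivative (\<lambda>h. Re h *\<^sub>R va w + Im h *\<^sub>R vb w)) (at w)" if w: "w \<in> N" for w
  proof -
    have "((\<lambda>w. divD (f (\<tau> I w) - f (\<tau> J w))) has_derivative (\<lambda>h. divD
       ((Re h *\<^sub>R fa I w + Im h *\<^sub>R fb I w) - (Re h *\<^sub>R fa J w + Im h *\<^sub>R fb J w)))) (at w)"
      by (intro divD.has_derivative has_derivative_diff f_deriv in_B w)
    also have "(\<lambda>h. divD ((Re h *\<^sub>R fa I w + Im h *\<^sub>R fb I w) - (Re h *\<^sub>R fa J w + Im h *\<^sub>R fb J w))) =
        (\<lambda>h. Re h *\<^sub>R va w + Im h *\<^sub>R vb w)"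
      by (simp add: va_def vb_def divD.add divD.diff divD.scaleR algebra_simps)
    finally show ?thesis
      by (rule has_derivative_transform_within_open[OF _ _ w]) (simp_all add: N_def v_eq)
  qed
  have u_deriv: "(u has_derivative (\<lambda>h. Re h *\<^sub>R ua w + Im h *\<^sub>R ub w)) (at w)" if w: "w \<in> N" for w
  proof -
    have "((\<lambda>w. f (\<tau> I w) - I \<odot> v w) has_derivative (\<lambda>h.
       (Re h *\<^sub>R fa I w + Im h *\<^sub>R fb I w) - I \<odot> (Re h *\<^sub>R va w + Im h *\<^sub>R vb w))) (at w)"
      by (intro bounded_linear.has_derivative[OF oct.bounded_linear_right] has_derivative_diff
          f_deriv in_B v_deriv w)
    also have "(\<lambda>h. (Re h *\<^sub>R fa I w + Im h *\<^sub>R fb I w) - I \<odot> (Re h *\<^sub>R va w + Im h *\<^sub>R vb w)) =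
        (\<lambda>h. Re h *\<^sub>R ua w + Im h *\<^sub>R ub w)"
      by (simp add: ua_def ub_def oct.add_right oct.scaleR_right algebra_simps)
    finally show ?thesis
      by (rule has_derivative_transform_within_open[OF _ _ w]) (simp_all add: N_def u_eq)
  qed
  have f'_cont_K: "continuous_on N (\<lambda>w. f' (\<tau> K w))" if "K = I \<or> K = J" for K
  proof (rule continuous_on_compose2[OF f'_cont])
    show "continuous_on N (\<lambda>w. \<tau> K w)" unfolding slice_embed_def by (intro continuous_intros)
    show "(\<lambda>w. \<tau> K w) ` N \<subseteq> \<Omega>" using that in_B B_sub by auto
  qed
  have cont_v: "continuous_on N va" "continuous_on N vb"
    unfolding va_def vb_def fa_def fb_def
    by (intro divD.continuous_on continuous_intros f'_cont_K; simp)+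
  have cont_u: "continuous_on N ua" "continuous_on N ub"
    unfolding ua_def ub_def fa_def fb_def
    by (intro bounded_linear.continuous_on[OF oct.bounded_linear_right] continuous_intros f'_cont_K cont_v; simp)+
  have system: "ua w - vb w - (2 / Im w) *\<^sub>R v w = 0" "ub w + va w = 0"
    if w: "w \<in> N" "Im w \<noteq> 0" for w
  proof -
    \<comment> \<open>The right-hand side is written as a slice value too, so that
      \<open>imag_unit_pair_unique\<close> for I and J makes both brackets vanish.\<close>
    have eq: "(ua w - vb w - (2 / Im w) *\<^sub>R v w) + K \<odot> (ub w + va w) = 0 + K \<odot> 0"
      if K: "K = I \<or> K = J" for K
    proof -
      have KS: "K \<in> \<SS>" and KB: "\<tau> K w \<in> B" using K I J in_B[OF w(1)] by auto
      have "\<tau> K w \<in> \<Omega> - oct_reals" using KB KS B_sub w by (auto simp: slice_embed_real_iff)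
      then have "slice_fueter_op f (\<tau> K w) = 0" using f by (simp add: slice_fueter_regular_def)
      moreover have fK: "(f has_derivative blinfun_apply (f' (\<tau> K w))) (at (\<tau> K w))"
        using KB B_sub by (intro f') auto
      have "slice_fueter_op f (\<tau> K w) = fa K w + K \<odot> fb K w - (2 / Im w) *\<^sub>R v w"
        unfolding fa_def fb_def
        by (rule slice_fueter_op_tangential[OF fK KS w(2)
              stem_tangential_derivative[OF fK B_open KB uv KS]])
      moreover have "fa K w = ua w + K \<odot> va w" "fb K w = ub w + K \<odot> vb w"
        using K fab by auto
      ultimately show ?thesis
        by (simp add: oct.add_right imag_units_mult_mult[OF KS] oct.zero_right algebra_simps)
    qed
    show "ua w - vb w - (2 / Im w) *\<^sub>R v w = 0" "ub w + va w = 0"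
      using imag_unit_pair_unique[OF I(1) J(1) J(2)[symmetric] eq eq] by simp_all
  qed
  have bv2: "ub w + va w = 0" if w: "w \<in> N" for w
  proof (cases "Im w = 0")
    case True
    \<comment> \<open>On the axis the operator gives no information; the equation is the limit of
      the one at w + it as t decreases to 0.\<close>
    define \<phi> where "\<phi> w = ub w + va w" for w
    define p where "p t = w + \<i> * of_real t" for t :: real
    have "open N" by (simp add: N_def)
    have "continuous_on N \<phi>" unfolding \<phi>_def by (intro continuous_intros cont_u cont_v)
    then have "isCont \<phi> (p 0)" using \<open>open N\<close> w by (simp add: continuous_on_eq_continuous_at p_def)
    moreover have p: "isCont p 0" unfolding p_def by (intro continuous_intros)
    ultimately have "isCont (\<lambda>t. \<phi> (p t)) 0" by (rule isCont_o2[rotated])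
    then have "((\<lambda>t. \<phi> (p t)) \<longlongrightarrow> \<phi> (p 0)) (at_right 0)"
      by (simp add: isCont_def filterlim_at_split)
    moreover have "((\<lambda>t. \<phi> (p t)) \<longlongrightarrow> 0) (at_right 0)"
    proof (rule tendsto_eventually)
      have "(p \<longlongrightarrow> p 0) (at_right 0)" using p by (simp add: isCont_def filterlim_at_split)
      then have "\<forall>\<^sub>F t in at_right 0. p t \<in> N"
        by (rule topological_tendstoD) (use \<open>open N\<close> w in \<open>simp_all add: p_def\<close>)
      moreover have "\<forall>\<^sub>F t in at_right (0::real). t > 0" by (rule eventually_at_right_less)
      ultimately show "\<forall>\<^sub>F t in at_right 0. \<phi> (p t) = 0"
        by eventually_elim (use True system(2) in \<open>simp add: \<phi>_def p_def\<close>)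
    qed
    ultimately have "\<phi> (p 0) = 0" by (intro tendsto_unique[OF trivial_limit_at_right_real])
    then show ?thesis by (simp add: \<phi>_def p_def)
  qed (use system w in blast)
  have bv1: "Im w *\<^sub>R (ua w - vb w) = 2 *\<^sub>R v w" if w: "w \<in> N" for w
  proof (cases "Im w = 0")
    case True
    \<comment> \<open>Both slices meet in the same real point, so v vanishes there and both sides
      are zero.\<close>
    then have "\<tau> I w = \<tau> J w" by (simp add: slice_embed_def)
    then have "v w = 0" using v_eq[OF w] by (simp add: divD.zero)
    with True show ?thesis by simp
  next
    case False
    then have "ua w - vb w = (2 / Im w) *\<^sub>R v w" using system(1)[OF w] by simp
    then show ?thesis using False by simp
  qed
  show ?thesis
    by (rule exI[of _ "r / 2"], rule exI[of _ ua], rule exI[of _ ub], rule exI[of _ va], rule exI[of _ vb])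
      (use r in_B u_deriv v_deriv bv1 bv2 cont_u cont_v in \<open>simp add: N_def\<close>)
qed

section \<open>Local stem functions as Bers-Vekua pairs\<close>

lemma real_analytic_on_componentwise:
  assumes "\<And>w i. w \<in> U \<Longrightarrow> real_analytic_at (\<lambda>z. u z $ i) w"
  shows "real_analytic_on u U"
  unfolding real_analytic_on_def
proof
  fix w assume "w \<in> U"
  then have "\<forall>i. \<exists>r c. r > 0 \<and> (\<forall>z\<in>ball w r.
      ((\<lambda>(j, k). (Re (z - w) ^ j * Im (z - w) ^ k) * c j k) has_sum u z $ i) UNIV)"
    using assms[of w] unfolding real_analytic_at_def by simp
  from choice[OF this] obtain r where "\<forall>i. \<exists>c. r i > 0 \<and> (\<forall>z\<in>ball w (r i).
      ((\<lambda>(j, k). (Re (z - w) ^ j * Im (z - w) ^ k) * c j k) has_sum u z $ i) UNIV)"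
    by (elim exE)
  from choice[OF this] obtain c where rc: "\<forall>i. r i > 0 \<and> (\<forall>z\<in>ball w (r i).
      ((\<lambda>(j, k). (Re (z - w) ^ j * Im (z - w) ^ k) * c i j k) has_sum u z $ i) UNIV)"
    by (elim exE)
  have r: "r i > 0" for i using rc by simp
  have c: "((\<lambda>(j, k). (Re (z - w) ^ j * Im (z - w) ^ k) * c i j k) has_sum u z $ i) UNIV"
    if "z \<in> ball w (r i)" for i z
    using rc that by simp
  define \<rho> where "\<rho> = Min (range r)"
  have "\<rho> > 0" using r by (simp add: \<rho>_def)
  moreover have "((\<lambda>(j, k). (Re (z - w) ^ j * Im (z - w) ^ k) *\<^sub>R (\<chi> i. c i j k)) has_sum u z) UNIV"
    if z: "z \<in> ball w \<rho>" for z
    unfolding has_sum_def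
  proof (rule vec_tendstoI)
    fix i
    have "\<rho> \<le> r i" by (simp add: \<rho>_def)
    then have "z \<in> ball w (r i)" using z by simp
    from c[OF this] show "((\<lambda>F. (\<Sum>(j, k)\<in>F. (Re (z - w) ^ j * Im (z - w) ^ k) *\<^sub>R (\<chi> i. c i j k)) $ i)
        \<longlongrightarrow> u z $ i) (finite_subsets_at_top UNIV)"
      by (simp add: has_sum_def case_prod_unfold)
  qed
  ultimately show "\<exists>r>0. \<exists>c. \<forall>z\<in>ball w r.
      ((\<lambda>(i, j). (Re (z - w) ^ i * Im (z - w) ^ j) *\<^sub>R c i j) has_sum u z) UNIV"
    by (intro exI[of _ \<rho>] conjI exI[of _ "\<lambda>j k. \<chi> i. c i j k"] ballI)
qed

lemma partial_alpha_eq: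
  assumes "(u has_derivative (\<lambda>h. Re h *\<^sub>R a + Im h *\<^sub>R b)) (at z)"
  shows "partial_alpha u z = a"
proof -
  have "((\<lambda>t. z + of_real t) has_derivative (\<lambda>t. of_real t)) (at 0)"
    by (auto intro!: derivative_eq_intros)
  moreover have "(u has_derivative (\<lambda>h. Re h *\<^sub>R a + Im h *\<^sub>R b)) (at (z + of_real 0))"
    using assms by simp
  ultimately have "((\<lambda>t. u (z + of_real t)) has_derivative (\<lambda>t. Re (of_real t) *\<^sub>R a + Im (of_real t) *\<^sub>R b)) (at 0)"
    by (rule has_derivative_compose)
  then show ?thesis
    by (simp add: partial_alpha_def vector_derivative_at has_vector_derivative_def)
qed

lemma partial_beta_eq:
  assumes "(u has_derivative (\<lambda>h. Re h *\<^sub>R a + Im h *\<^sub>R b)) (at z)"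
  shows "partial_beta u z = b"
proof -
  have "((\<lambda>t. z + of_real t * \<i>) has_derivative (\<lambda>t. of_real t * \<i>)) (at 0)"
    by (auto intro!: derivative_eq_intros)
  moreover have "(u has_derivative (\<lambda>h. Re h *\<^sub>R a + Im h *\<^sub>R b)) (at (z + of_real 0 * \<i>))"
    using assms by simp
  ultimately have "((\<lambda>t. u (z + of_real t * \<i>)) has_derivative
      (\<lambda>t. Re (of_real t * \<i>) *\<^sub>R a + Im (of_real t * \<i>) *\<^sub>R b)) (at 0)"
    by (rule has_derivative_compose)
  then show ?thesis
    by (simp add: partial_beta_def vector_derivative_at has_vector_derivative_def)
qed

text \<open>The system has real coefficients, so each of the eight components solves the scalar one;
  analyticity at w uses a smaller ball around w. The slice of I over the ball stays in B, which is
  what the comparison of germs needs.\<close>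

lemma local_stem_in_bers_vekua:
  assumes "open \<Omega>" "slice_fueter_regular \<Omega> f" "open_ball_in \<Omega> B" "I \<in> \<SS>" "\<tau> I z \<in> B"
  shows "\<exists>R>0. (\<forall>w\<in>ball z R. \<tau> I w \<in> B) \<and> local_stem \<Omega> f B \<in> bers_vekua (ball z R)"
proof -
  define u v where "u = fst (local_stem \<Omega> f B)" and "v = snd (local_stem \<Omega> f B)"
  from local_stem_C1_system[OF assms, folded u_def v_def]
  obtain R ua ub va vb where R: "R > 0" and sys: "\<forall>w\<in>ball z R. \<tau> I w \<in> B \<and>
      (u has_derivative (\<lambda>h. Re h *\<^sub>R ua w + Im h *\<^sub>R ub w)) (at w) \<and>
      (v has_derivative (\<lambda>h. Re h *\<^sub>R va w + Im h *\<^sub>R vb w)) (at w) \<and>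
      Im w *\<^sub>R (ua w - vb w) = 2 *\<^sub>R v w \<and> ub w + va w = 0"
    and cont: "continuous_on (ball z R) ua" "continuous_on (ball z R) ub"
      "continuous_on (ball z R) va" "continuous_on (ball z R) vb"
    by (elim exE conjE) (rule that)
  have B: "\<tau> I w \<in> B"
    and u: "(u has_derivative (\<lambda>h. Re h *\<^sub>R ua w + Im h *\<^sub>R ub w)) (at w)"
    and v: "(v has_derivative (\<lambda>h. Re h *\<^sub>R va w + Im h *\<^sub>R vb w)) (at w)"
    and bv1: "Im w *\<^sub>R (ua w - vb w) = 2 *\<^sub>R v w"
    and bv2: "ub w + va w = 0" if "w \<in> ball z R" for w
    using bspec[OF sys that] by - (elim conjE, assumption)+
  have analytic: "real_analytic_at (\<lambda>z. u z $ i) w" "real_analytic_at (\<lambda>z. v z $ i) w"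
    if w: "w \<in> ball z R" for w i
  proof -
    obtain e where e: "e > 0" "ball w e \<subseteq> ball z R" using w open_ball openE by blast
    have comp: "((\<lambda>z. g z $ i) has_derivative (\<lambda>h. Re h * a $ i + Im h * b $ i)) (at x)"
      if "(g has_derivative (\<lambda>h. Re h *\<^sub>R a + Im h *\<^sub>R b)) (at x)" for g :: "complex \<Rightarrow> octonion" and a b x
      using bounded_linear.has_derivative[OF bounded_linear_vec_nth that, of i] by simp
    have comp_cont: "continuous_on (ball w e) (\<lambda>z. g z $ i)" if "continuous_on (ball z R) g"
      for g :: "complex \<Rightarrow> octonion"
      using continuous_on_subset[OF that e(2)] by (intro continuous_intros)
    have sub: "x \<in> ball z R" if "x \<in> ball w e" for x using that e(2) by blast
    have bv1': "Im x * (ua x $ i - vb x $ i) = 2 * v x $ i" if "x \<in> ball w e" for x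
      using arg_cong[OF bv1[OF sub[OF that]], of "\<lambda>y. y $ i"] by simp
    have bv2': "ub x $ i + va x $ i = 0" if "x \<in> ball w e" for x
      using arg_cong[OF bv2[OF sub[OF that]], of "\<lambda>y. y $ i"] by simp
    note scalar = bers_vekua_imp_real_analytic_at[OF e(1) comp[OF u[OF sub]] comp[OF v[OF sub]]
        cont[THEN comp_cont] bv1' bv2']
    show "real_analytic_at (\<lambda>z. u z $ i) w" by (rule scalar(1))
    show "real_analytic_at (\<lambda>z. v z $ i) w" by (rule scalar(2))
  qed
  have "real_analytic_on u (ball z R)" "real_analytic_on v (ball z R)"
    by (intro real_analytic_on_componentwise analytic; assumption)+
  moreover have "partial_alpha u w - partial_beta v w = (2 / Im w) *\<^sub>R v w" if "w \<in> ball z R - \<real>" for w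
  proof -
    have w: "w \<in> ball z R" "Im w \<noteq> 0" using that by (auto simp: complex_is_Real_iff)
    then have "ua w - vb w = (1 / Im w) *\<^sub>R (Im w *\<^sub>R (ua w - vb w))" by simp
    also have "\<dots> = (2 / Im w) *\<^sub>R v w" by (simp add: bv1[OF w(1)])
    finally show ?thesis by (simp add: partial_alpha_eq[OF u[OF w(1)]] partial_beta_eq[OF v[OF w(1)]])
  qed
  moreover have "partial_beta u w + partial_alpha v w = 0" if "w \<in> ball z R" for w
    by (simp add: partial_alpha_eq[OF v[OF that]] partial_beta_eq[OF u[OF that]] bv2[OF that])
  ultimately have "(u, v) \<in> bers_vekua (ball z R)" by (simp add: bers_vekua_def)
  then show ?thesis using R B by (intro exI[of _ R]) (simp add: u_def v_def)
qed

section \<open>Germs and continuation\<close>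

lemma bers_vekua_at_iff: "p \<in> bers_vekua_at z \<longleftrightarrow> (\<exists>U. open U \<and> z \<in> U \<and> p \<in> bers_vekua U)"
  by (auto simp: bers_vekua_at_def)

text \<open>Transitivity, by intersecting neighbourhoods. Equality of germs follows by exchanging
  the two pairs.\<close>

lemma germ_of_subset:
  assumes "p \<in> bers_vekua_at z" "q \<in> bers_vekua_at z" "open N" "z \<in> N"
    and "\<And>w. w \<in> N \<Longrightarrow> fst p w = fst q w \<and> snd p w = snd q w"
  shows "germ_of q z \<subseteq> germ_of p z"
proof
  fix r assume r: "r \<in> germ_of q z"
  then obtain M where M: "r \<in> bers_vekua_at z" "open M" "z \<in> M"
    "\<And>w. w \<in> M \<Longrightarrow> fst q w = fst r w \<and> snd q w = snd r w"
    by (cases q, cases r) (auto simp: germ_of_def germ_rel_def)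
  have "open (N \<inter> M)" "z \<in> N \<inter> M" using M assms by auto
  moreover have "\<forall>w\<in>N \<inter> M. fst p w = fst r w \<and> snd p w = snd r w" using M assms by simp
  ultimately show "r \<in> germ_of p z"
    using M(1) assms(1) unfolding germ_of_def germ_rel_def by (cases p, cases r) auto
qed

text \<open>For two balls containing \<open>\<tau> I z\<close>, both local stems equal the signed
  stem vector on the slice of I near z, which depends on no ball; so the germs agree.\<close>

lemma I_germ_eq:
  assumes \<Omega>: "open \<Omega>" and f: "slice_fueter_regular \<Omega> f" and B: "open_ball_in \<Omega> B"
    and I: "I \<in> \<SS>" "\<tau> I z \<in> B"
  shows "I_germ \<Omega> f z I = germ_of (local_stem \<Omega> f B) z"
proof -
  have slice: "slice_function \<Omega> f" using f by (simp add: slice_fueter_regular_def)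
  have sub: "germ_of (local_stem \<Omega> f B2) z \<subseteq> germ_of (local_stem \<Omega> f B1) z"
    if B1: "open_ball_in \<Omega> B1" "\<tau> I z \<in> B1" and B2: "open_ball_in \<Omega> B2" "\<tau> I z \<in> B2" for B1 B2
  proof -
    obtain R1 where R1: "R1 > 0" "\<forall>w\<in>ball z R1. \<tau> I w \<in> B1" "local_stem \<Omega> f B1 \<in> bers_vekua (ball z R1)"
      using local_stem_in_bers_vekua[OF \<Omega> f B1(1) I(1) B1(2)] by blast
    obtain R2 where R2: "R2 > 0" "\<forall>w\<in>ball z R2. \<tau> I w \<in> B2" "local_stem \<Omega> f B2 \<in> bers_vekua (ball z R2)"
      using local_stem_in_bers_vekua[OF \<Omega> f B2(1) I(1) B2(2)] by blast
    show ?thesis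
    proof (rule germ_of_subset[where N = "ball z R1 \<inter> ball z R2"])
      show "local_stem \<Omega> f B1 \<in> bers_vekua_at z"
        unfolding bers_vekua_at_iff using R1 by (intro exI[of _ "ball z R1"]) simp
      show "local_stem \<Omega> f B2 \<in> bers_vekua_at z"
        unfolding bers_vekua_at_iff using R2 by (intro exI[of _ "ball z R2"]) simp
      show "fst (local_stem \<Omega> f B1) w = fst (local_stem \<Omega> f B2) w \<and>
          snd (local_stem \<Omega> f B1) w = snd (local_stem \<Omega> f B2) w" if "w \<in> ball z R1 \<inter> ball z R2" for w
        using that R1(2) R2(2) local_stem_value_eq(1)[OF \<Omega> slice B1(1) I(1), of w]
          local_stem_value_eq(1)[OF \<Omega> slice B2(1) I(1), of w]
        by (simp add: local_stem_def)
    qed (use R1(1) R2(1) in auto)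
  qed
  show ?thesis
    unfolding I_germ_def
  proof (rule the_equality)
    show "\<exists>B'. open_ball_in \<Omega> B' \<and> \<tau> I z \<in> B' \<and> germ_of (local_stem \<Omega> f B) z = germ_of (local_stem \<Omega> f B') z"
      using B I by blast
    fix \<phi>
    assume "\<exists>B'. open_ball_in \<Omega> B' \<and> \<tau> I z \<in> B' \<and> \<phi> = germ_of (local_stem \<Omega> f B') z"
    then obtain B' where "open_ball_in \<Omega> B'" "\<tau> I z \<in> B'" "\<phi> = germ_of (local_stem \<Omega> f B') z"
      by blast
    then show "\<phi> = germ_of (local_stem \<Omega> f B) z"
      using sub[OF B I(2)] sub[OF _ _ B I(2)] by blast
  qed
qed

theorem theorem4p12:
  fixes \<Omega> :: "octonion set"
    and f :: "octonion \<Rightarrow> octonion"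
    and \<gamma> :: "real \<Rightarrow> complex"
    and \<Theta> :: "real \<Rightarrow> octonion"
  assumes "open \<Omega>" and "connected \<Omega>" and "\<Omega> \<noteq> {}"
    and "slice_fueter_regular \<Omega> f"
    and "path \<gamma>"
    and "path \<Theta>" and "path_image \<Theta> \<subseteq> \<SS>"
    and "path_image (circular_lifting \<gamma> \<Theta>) \<subseteq> \<Omega>"
  shows "bv_continuation \<gamma> (\<lambda>t. I_germ \<Omega> f (\<gamma> t) (\<Theta> t))"
proof -
  let ?J = "{0..1::real}"
  have \<gamma>: "continuous_on ?J \<gamma>" and \<Theta>: "continuous_on ?J \<Theta>"
    using assms(5,6) by (simp_all add: path_def)
  then have lift: "continuous_on ?J (\<lambda>t. \<tau> (\<Theta> t) (\<gamma> t))"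
    unfolding slice_embed_def by (intro continuous_intros)
  have \<Theta>_unit: "\<Theta> t \<in> \<SS>" and lift_in: "\<tau> (\<Theta> t) (\<gamma> t) \<in> \<Omega>" if "t \<in> ?J" for t
    using assms(7,8) that by (auto simp: path_image_def circular_lifting_def)
  have ball: "\<exists>B. open_ball_in \<Omega> B \<and> \<tau> (\<Theta> t) (\<gamma> t) \<in> B" if t: "t \<in> ?J" for t
  proof -
    obtain r where "r > 0" "ball (\<tau> (\<Theta> t) (\<gamma> t)) r \<subseteq> \<Omega>"
      using assms(1) lift_in[OF t] openE by blast
    then show ?thesis
      by (intro exI[of _ "ball (\<tau> (\<Theta> t) (\<gamma> t)) r"]) (auto simp: open_ball_in_def)
  qed
  note stem = local_stem_in_bers_vekua[OF assms(1,4)] and germ = I_germ_eq[OF assms(1,4)]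
  show ?thesis
    unfolding bv_continuation_def
  proof (intro conjI ballI)
    fix t assume t: "t \<in> ?J"
    obtain B where B: "open_ball_in \<Omega> B" "\<tau> (\<Theta> t) (\<gamma> t) \<in> B" using ball[OF t] by blast
    obtain R where R: "R > 0" "local_stem \<Omega> f B \<in> bers_vekua (ball (\<gamma> t) R)"
      using stem[OF B(1) \<Theta>_unit[OF t] B(2)] by blast
    have "local_stem \<Omega> f B \<in> bers_vekua_at (\<gamma> t)"
      unfolding bers_vekua_at_iff using R by (intro exI[of _ "ball (\<gamma> t) R"]) simp
    then show "I_germ \<Omega> f (\<gamma> t) (\<Theta> t) \<in> bv_germs (\<gamma> t)"
      unfolding germ[OF B(1) \<Theta>_unit[OF t] B(2)] germ_of_def bv_germs_def by (rule quotientI)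
  next
    fix t0 assume t0: "t0 \<in> ?J"
    obtain B where B: "open_ball_in \<Omega> B" "\<tau> (\<Theta> t0) (\<gamma> t0) \<in> B" using ball[OF t0] by blast
    obtain R where R: "R > 0" "local_stem \<Omega> f B \<in> bers_vekua (ball (\<gamma> t0) R)"
      using stem[OF B(1) \<Theta>_unit[OF t0] B(2)] by blast
    \<comment> \<open>The two conditions have separate roles: \<gamma> stays where the local stem of
      B is known to be a Bers-Vekua pair, and the lifting stays in B, so that B computes the germ at
      \<gamma>(t) for the unit \<Theta>(t), not merely for \<Theta>(t0).\<close>
    define T where "T = ?J \<inter> (\<lambda>t. (\<gamma> t, \<tau> (\<Theta> t) (\<gamma> t))) -` (ball (\<gamma> t0) R \<times> B)"
    have "open B" using B by (auto simp: open_ball_in_def)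
    then have "openin (top_of_set ?J) T"
      unfolding T_def by (intro continuous_openin_preimage_gen continuous_on_Pair \<gamma> lift open_Times open_ball)
    moreover have "t0 \<in> T" using t0 B R by (simp add: T_def)
    moreover have "I_germ \<Omega> f (\<gamma> t) (\<Theta> t) = germ_of (local_stem \<Omega> f B) (\<gamma> t)" if "t \<in> T" for t
      using that B(1) \<Theta>_unit by (intro germ) (auto simp: T_def)
    moreover have "T \<subseteq> ?J" "\<gamma> ` T \<subseteq> ball (\<gamma> t0) R" by (auto simp: T_def)
    ultimately show "\<exists>T U p. T \<subseteq> ?J \<and> (\<exists>V. openin (top_of_set ?J) V \<and> t0 \<in> V \<and> V \<subseteq> T) \<and>
        open U \<and> \<gamma> ` T \<subseteq> U \<and> p \<in> bers_vekua U \<and>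
        (\<forall>t\<in>T. I_germ \<Omega> f (\<gamma> t) (\<Theta> t) = germ_of p (\<gamma> t))"
      using R(2) by (intro exI[of _ T] exI[of _ "ball (\<gamma> t0) R"] exI[of _ "local_stem \<Omega> f B"]) auto
  qed
qed

end
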